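(* For every integer $r\geq 3$ and every real number $\xi$ with $0<\xi \leq \frac{3}{13+8\log_2 r}$, there exists $n_0\in\mathbb{N}$ such that for all integers $n\geq n_0$ the following holds: if $A\subseteq [n]$ and $|A|\geq (1-\xi)n$, then $$g_r(A)\le\binom{r}{2} 2^{|A|}+2^{-\frac{n}{36\log_2n}}2^n.$$
   Context: $[n]=\{1,2,\ldots,n\}$. A 3-term arithmetic progression (3-AP) of $A\subseteq[n]$ is a sequence $a, a+d, a+2d$ of elements of $A$ with $d\in[n]$ (so $d\ge 1$). An $r$-coloring of $A$ is any map $c\colon A\to[r]$ (not necessarily surjective). A 3-AP of $A$ is rainbow under $c$ if its three terms have pairwise distinct colors; $c$ is rainbow 3-AP-free if no 3-AP of $A$ is rainbow. $g_r(A)$ denotes the number of rainbow 3-AP-free $r$-colorings of $A$. *)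

theory Defs
  imports Complex_Main "HOL-Library.FuncSet"
begin

text \<open>
  The common difference is only required to be positive: for a set
  \<open>A \<subseteq> {1..n}\<close> the bound \<open>d \<le> n\<close> holds automatically.
\<close>

definition three_APs :: "nat set \<Rightarrow> (nat \<times> nat \<times> nat) set" where
  "three_APs A =
     {(a, a + d, a + 2 * d) | a d. d \<ge> 1 \<and> a \<in> A \<and> a + d \<in> A \<and> a + 2 * d \<in> A}"

definition colorings :: "nat \<Rightarrow> nat set \<Rightarrow> (nat \<Rightarrow> nat) set" where
  "colorings r A = A \<rightarrow>\<^sub>E {1..r}"

definition rainbow :: "(nat \<Rightarrow> nat) \<Rightarrow> nat \<times> nat \<times> nat \<Rightarrow> bool" where
  "rainbow c = (\<lambda>(x, y, z). c x \<noteq> c y \<and> c y \<noteq> c z \<and> c x \<noteq> c z)"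

definition rainbow_3AP_free :: "nat set \<Rightarrow> (nat \<Rightarrow> nat) \<Rightarrow> bool" where
  "rainbow_3AP_free A c \<longleftrightarrow> (\<forall>t\<in>three_APs A. \<not> rainbow c t)"

definition num_rainbow_free :: "nat \<Rightarrow> nat set \<Rightarrow> nat" where
  "num_rainbow_free r A = card {c \<in> colorings r A. rainbow_3AP_free A c}"

end

theory Submission
  imports Defs
begin

text \<open>
  A rainbow 3-AP-free coloring is an independent set of the 3-uniform system of rainbow
  progressions on \<open>A \<times> {1..r}\<close>, and a container argument covers all of them by \<open>2 powr (\<epsilon> * n)\<close>
  assignments of colour lists to \<open>A\<close> that admit few rainbow progressions. A list of size at
  least 3 at \<open>x\<close> forces the other two lists of most progressions through \<open>x\<close> to be equal singletons,
  so linearly many such lists leave too few choices elsewhere; this is where the bound on \<open>\<xi>\<close>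
  enters. Otherwise either linearly many lists are singletons, or nearly all lists have size 2,
  and as \<open>A\<close> is dense they are then nearly all the same pair. In that last case a single element
  of a third colour ties the colours of a linear number of disjoint pairs to each other.
  Hence colorings with at least three colours number at most \<open>2 powr ((1 - \<gamma>) * n)\<close>.
\<close>

text \<open>Containers are needed at one fixed density only: their parameters depend on
  \<open>r\<close> and \<open>\<xi>\<close> but not on \<open>n\<close>. Two vertices of
  \<open>A \<times> {1..r}\<close> have at most \<open>3 * r\<close> common completions to a rainbow
  triple, and this bounded codegree makes the number of containers exponential in an arbitrarily
  small multiple of \<open>n\<close>. The resulting saving in the exponent is linear in
  \<open>n\<close>, so it eventually exceeds \<open>n / (36 * log 2 n)\<close>. Origin of the
  threshold: put l = log 2 r and let m \<le> \<xi> * n be the number of gaps of \<open>A\<close>. Up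
  to small errors, if linearly many lists have size at least 3, there are at most 2m of them, and at
  most n/4 + 3m lists of size at least 2. The lists then admit at most 2 powr (n/4 + (2l + 3) * m)
  choices, and this exponent falls below n once \<xi> < 3 / (12 + 8l); the 13 gives strict room. The
  other obstacle is parity: midpoints relate only points of equal parity. Opposite parities are
  joined by progressions (x, y, 2y - x), of which each x starts only about n/4, and a gap destroys
  up to two of them. Hence m must stay below n/8, which the threshold ensures for r \<ge> 3.\<close>

subsection \<open>Containers for triple systems\<close>

text \<open>Exponential weighting: if \<open>R\<close> has weight \<open>exp (- L * card R)\<close>,
  the weights of all subsets of \<open>V\<close> sum to \<open>(1 + exp (- L)) ^ card V\<close>,
  while each counted \<open>R\<close> weighs at least \<open>exp (- K * L)\<close>. A large
  \<open>L\<close>, with \<open>K\<close> small against \<open>N / L\<close>, gives the exponential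
  of a small multiple of \<open>N\<close> without binomial estimates.\<close>

lemma card_subsets_le_exp:
  fixes K L N :: real
  assumes "finite V" and "real (card V) \<le> N" and "L \<ge> 0"
  shows "real (card {R. R \<subseteq> V \<and> real (card R) \<le> K}) \<le> exp (exp (- L) * N + K * L)"
proof -
  let ?S = "{R. R \<subseteq> V \<and> real (card R) \<le> K}"
  have "real (card ?S) * exp (- (K * L)) = (\<Sum>R\<in>?S. exp (- (K * L)))"
    by simp
  also have "\<dots> \<le> (\<Sum>R\<in>?S. exp (- L) ^ card R)"
    using \<open>L \<ge> 0\<close> by (intro sum_mono) (auto simp: exp_of_nat_mult [symmetric] intro!: mult_right_mono)
  also have "\<dots> \<le> (\<Sum>R\<in>Pow V. exp (- L) ^ card R)"
    using \<open>finite V\<close> by (intro sum_mono2) auto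
  also have "\<dots> = (\<Prod>v\<in>V. exp (- L) + 1)"
    using prod_add [OF \<open>finite V\<close>, of "\<lambda>_. exp (- L)" "\<lambda>_. 1"] by simp
  also have "\<dots> \<le> (\<Prod>v\<in>V. exp (exp (- L)))"
    by (intro prod_mono) (use exp_ge_add_one_self [of "exp (- L)"] in \<open>auto simp: add.commute\<close>)
  also have "\<dots> = exp (card V * exp (- L))"
    by (simp add: exp_of_nat_mult)
  also have "\<dots> \<le> exp (exp (- L) * N)"
    using assms(2) by (simp add: mult.commute)
  finally have "real (card ?S) * exp (- (K * L)) * exp (K * L) \<le> exp (exp (- L) * N) * exp (K * L)"
    by (rule mult_right_mono) simp
  then show ?thesis
    by (simp add: mult.assoc flip: exp_add)
qed

text \<open>Edges are stored as a ternary relation closed under all permutations, so the counts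
  below are of ordered triples and any vertex of an edge can be put first. The codegree bound
  \<open>D\<close> is the only regularity on which the container argument rests.\<close>

locale triple_system =
  fixes V :: "'a set" and H :: "('a \<times> 'a \<times> 'a) set" and D :: nat
  assumes finite_V: "finite V"
    and swap12: "(u, v, w) \<in> H \<Longrightarrow> (v, u, w) \<in> H"
    and swap23: "(u, v, w) \<in> H \<Longrightarrow> (u, w, v) \<in> H"
    and codegree: "card {w \<in> V. (u, v, w) \<in> H} \<le> D"
    and D_pos: "D \<ge> 1"
begin

definition deg :: "'a set \<Rightarrow> 'a \<Rightarrow> nat" where
  "deg U v = card {(u, w). u \<in> U \<and> w \<in> U \<and> (v, u, w) \<in> H}"

text \<open>Neighbourhood of \<open>u\<close> in the link graph of \<open>F\<close>, where two
  points are joined if some \<open>v\<close> in \<open>F\<close> completes them to a triple. An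
  independent set containing \<open>F\<close> is independent in this graph, which reduces triples to
  pairs.\<close>

definition link :: "'a set \<Rightarrow> 'a set \<Rightarrow> 'a \<Rightarrow> 'a set" where
  "link U F u = {w \<in> U. \<exists>v\<in>F. (v, u, w) \<in> H}"

definition heavy :: "'a set \<Rightarrow> real \<Rightarrow> 'a set" where
  "heavy U a = {v \<in> U. real (deg U v) \<ge> a}"

definition linked :: "'a set \<Rightarrow> 'a set \<Rightarrow> 'a set \<Rightarrow> 'a set" where
  "linked U F R = (\<Union>u\<in>R. link U F u)"

text \<open>The container with fingerprint \<open>F\<close>, \<open>R\<close>: it depends on the
  independent set only through these two sets, so counting fingerprints bounds the number of
  containers. Link neighbours of \<open>R\<close> are dropped because an independent set containing
  \<open>F\<close> and \<open>R\<close> cannot meet them.\<close>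

definition sparse_part :: "'a set \<Rightarrow> 'a set \<Rightarrow> real \<Rightarrow> 'a set \<Rightarrow> 'a set" where
  "sparse_part U F d R = {u \<in> U - linked U F R. real (card (link U F u - linked U F R)) < d}"

lemma card_cube_eq_sum_deg:
  assumes "U \<subseteq> V"
  shows "card (H \<inter> U \<times> U \<times> U) = (\<Sum>v\<in>U. deg U v)"
proof -
  have fin: "finite U" using assms finite_V finite_subset by blast
  have "H \<inter> U \<times> U \<times> U = (SIGMA v:U. {(u, w). u \<in> U \<and> w \<in> U \<and> (v, u, w) \<in> H})"
    by auto
  moreover have "finite {(u, w). u \<in> U \<and> w \<in> U \<and> (v, u, w) \<in> H}" for v
    by (rule finite_subset [of _ "U \<times> U"]) (use fin in auto)
  ultimately show ?thesis
    using fin by (simp add: card_SigmaI deg_def)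
qed

lemma deg_le:
  assumes "U \<subseteq> V"
  shows "deg U v \<le> card U * D"
proof -
  have fin: "finite U" using assms finite_V finite_subset by blast
  have "{(u, w). u \<in> U \<and> w \<in> U \<and> (v, u, w) \<in> H} = (SIGMA u:U. {w\<in>U. (v, u, w) \<in> H})"
    by auto
  then have "deg U v = (\<Sum>u\<in>U. card {w\<in>U. (v, u, w) \<in> H})"
    using fin by (simp add: deg_def card_SigmaI)
  also have "\<dots> \<le> (\<Sum>u\<in>U. D)"
  proof (intro sum_mono)
    fix u
    have "card {w\<in>U. (v, u, w) \<in> H} \<le> card {w\<in>V. (v, u, w) \<in> H}"
      using assms finite_V by (intro card_mono) auto
    then show "card {w\<in>U. (v, u, w) \<in> H} \<le> D"
      using codegree [of v u] by linarith
  qed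
  finally show ?thesis by simp
qed

text \<open>Light vertices account for at most half of the \<open>\<delta> * N\<^sup>2\<close>
  ordered triples, and each heavy vertex is first in at most \<open>N * D\<close> of them.\<close>

lemma card_heavy_ge:
  fixes N \<delta> :: real
  assumes "U \<subseteq> V" and "real (card V) \<le> N" and "0 < N" and "\<delta> > 0"
    and "real (card (H \<inter> U \<times> U \<times> U)) \<ge> \<delta> * N\<^sup>2"
  shows "real (card (heavy U (\<delta> * N / 2))) \<ge> \<delta> * N / (2 * D)"
proof -
  have fin: "finite U" using assms finite_V finite_subset by blast
  have cU: "real (card U) \<le> N"
    using card_mono [OF finite_V \<open>U \<subseteq> V\<close>] assms(2) by linarith
  let ?B = "heavy U (\<delta> * N / 2)"
  have BU: "?B \<subseteq> U" by (auto simp: heavy_def)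
  have "\<delta> * N\<^sup>2 \<le> (\<Sum>v\<in>U. real (deg U v))"
    using assms(5) card_cube_eq_sum_deg [OF assms(1)] by simp
  also have "\<dots> = (\<Sum>v\<in>?B. real (deg U v)) + (\<Sum>v\<in>U - ?B. real (deg U v))"
    using fin BU by (metis sum.subset_diff add.commute)
  also have "(\<Sum>v\<in>?B. real (deg U v)) \<le> (\<Sum>v\<in>?B. N * D)"
  proof (intro sum_mono)
    fix v
    have "real (deg U v) \<le> real (card U * D)"
      using deg_le [OF assms(1)] of_nat_le_iff by blast
    also have "\<dots> \<le> N * D" using cU by (simp add: mult_right_mono)
    finally show "real (deg U v) \<le> N * D" .
  qed
  also have "(\<Sum>v\<in>U - ?B. real (deg U v)) \<le> (\<Sum>v\<in>U - ?B. \<delta> * N / 2)"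
    by (intro sum_mono) (auto simp: heavy_def)
  also have "\<dots> \<le> N * (\<delta> * N / 2)"
  proof -
    have "card (U - ?B) \<le> card U" using fin by (intro card_mono) auto
    then have "real (card (U - ?B)) \<le> N" using cU by linarith
    then show ?thesis using assms by (simp add: mult_right_mono)
  qed
  finally have "\<delta> * N\<^sup>2 / 2 \<le> card ?B * (N * D)"
    by (simp add: power2_eq_square field_simps)
  then have "N * (\<delta> * N / 2) \<le> N * (card ?B * D)"
    by (simp add: power2_eq_square field_simps)
  then have "\<delta> * N / 2 \<le> card ?B * D" using assms(3) by simp
  then show ?thesis using D_pos by (simp add: field_simps)
qed

lemma card_link_le:
  assumes "U \<subseteq> V" and "finite F"
  shows "card (link U F u) \<le> card F * D"
proof -
  have "link U F u \<subseteq> (\<Union>v\<in>F. {w \<in> V. (v, u, w) \<in> H})"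
    using assms by (auto simp: link_def)
  then have "card (link U F u) \<le> card (\<Union>v\<in>F. {w \<in> V. (v, u, w) \<in> H})"
    using assms finite_V by (intro card_mono) auto
  also have "\<dots> \<le> (\<Sum>v\<in>F. card {w \<in> V. (v, u, w) \<in> H})"
    by (intro card_UN_le assms)
  also have "\<dots> \<le> (\<Sum>v\<in>F. D)" by (intro sum_mono codegree)
  finally show ?thesis by simp
qed

text \<open>Several members of \<open>F\<close> may produce the same link edge, but by the codegree
  bound at most \<open>D\<close> of them do, so passing from triples to link edges loses only a
  factor \<open>D\<close>.\<close>

lemma card_link_edges_ge:
  fixes a :: real
  assumes "U \<subseteq> V" and "F \<subseteq> heavy U a"
  shows "a * card F \<le> D * real (card (SIGMA u:U. link U F u))"
proof -
  have fin: "finite U" using assms finite_V finite_subset by blast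
  have FU: "F \<subseteq> U" using assms by (auto simp: heavy_def)
  then have finF: "finite F" using fin finite_subset by blast
  let ?X = "SIGMA v:F. {(u, w). u \<in> U \<and> w \<in> U \<and> (v, u, w) \<in> H}"
  let ?Y = "SIGMA p:(SIGMA u:U. link U F u). {v \<in> F. (v, fst p, snd p) \<in> H}"
  have finx: "finite {(u, w). u \<in> U \<and> w \<in> U \<and> (v, u, w) \<in> H}" for v
    by (rule finite_subset [of _ "U \<times> U"]) (use fin in auto)
  have finl: "finite (link U F u)" for u using fin by (auto simp: link_def)
  have "a * card F = (\<Sum>v\<in>F. a)" by simp
  also have "\<dots> \<le> (\<Sum>v\<in>F. real (deg U v))"
    using assms by (intro sum_mono) (auto simp: heavy_def)
  also have "\<dots> = card ?X"
    using finF finx by (simp add: card_SigmaI deg_def)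
  also have "card ?X = card ?Y"
    by (rule bij_betw_same_card [of "\<lambda>(v, p). (p, v)"],
        rule bij_betwI [of _ _ _ "\<lambda>(p, v). (v, p)"]) (auto simp: link_def)
  also have "card ?Y = (\<Sum>p\<in>(SIGMA u:U. link U F u). card {v \<in> F. (v, fst p, snd p) \<in> H})"
    using fin finl finF by (intro card_SigmaI) auto
  also have "\<dots> \<le> (\<Sum>p\<in>(SIGMA u:U. link U F u). D)"
  proof (intro sum_mono)
    fix p :: "'a \<times> 'a"
    have "{v \<in> F. (v, fst p, snd p) \<in> H} \<subseteq> {v \<in> V. (fst p, snd p, v) \<in> H}"
      using FU assms swap12 swap23 by blast
    then have "card {v \<in> F. (v, fst p, snd p) \<in> H} \<le> card {v \<in> V. (fst p, snd p, v) \<in> H}"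
      using finite_V by (intro card_mono) auto
    then show "card {v \<in> F. (v, fst p, snd p) \<in> H} \<le> D"
      using codegree [of "fst p" "snd p"] by linarith
  qed
  also have "\<dots> = card (SIGMA u:U. link U F u) * D" by simp
  finally show ?thesis by (simp add: mult.commute)
qed

text \<open>The link graph of \<open>F\<close> has at least
  \<open>q * \<delta> * N / (2 * D)\<close> ordered edges and degrees at most \<open>q * D\<close>.
  At most \<open>d * N\<close>, half of that number, lie inside the sparse part; the other half must
  touch its complement, each point of which meets at most \<open>2 * q * D\<close> ordered
  edges.\<close>

lemma card_sparse_part_le:
  fixes N \<delta> d :: real
  assumes "U \<subseteq> V" and "real (card V) \<le> N" and "F \<subseteq> heavy U (\<delta> * N / 2)"
    and "card F = q" and "q > 0" and "d = q * \<delta> / (4 * D)" and "\<delta> > 0"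
  shows "real (card (sparse_part U F d R)) \<le> real (card U) - \<delta> / (8 * D\<^sup>2) * N"
proof -
  let ?C = "sparse_part U F d R"
  have fin: "finite U" using assms finite_V finite_subset by blast
  have cU: "real (card U) \<le> N"
    using card_mono [OF finite_V \<open>U \<subseteq> V\<close>] assms(2) by linarith
  have CU: "?C \<subseteq> U" by (auto simp: sparse_part_def)
  have finC: "finite ?C" and finUC: "finite (U - ?C)" using CU fin finite_subset by auto
  have finF: "finite F" using assms(4,5) card.infinite by force
  have d0: "d \<ge> 0" using assms by simp
  have D0: "real D > 0" using D_pos by simp
  have finl: "finite (link U F u)" for u using fin by (auto simp: link_def)
  have linkle: "real (card (link U F u)) \<le> real q * D" for u
    using card_link_le [OF assms(1) finF, of u] assms(4) by (metis of_nat_le_iff of_nat_mult)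
  have sym: "w \<in> U \<Longrightarrow> u \<in> link U F w" if "u \<in> U" "w \<in> link U F u" for u w
    using that swap23 by (auto simp: link_def)
  let ?E1 = "SIGMA u:?C. link U F u - linked U F R"
  let ?E2 = "SIGMA u:U - ?C. link U F u"
  have sub: "(SIGMA u:U. link U F u) \<subseteq> ?E1 \<union> (?E2 \<union> prod.swap ` ?E2)"
  proof
    fix p assume p: "p \<in> (SIGMA u:U. link U F u)"
    obtain u w where pe: "p = (u, w)" and u: "u \<in> U" and w: "w \<in> link U F u" using p by auto
    have wU: "w \<in> U" using w by (auto simp: link_def)
    show "p \<in> ?E1 \<union> (?E2 \<union> prod.swap ` ?E2)"
    proof (cases "u \<in> ?C \<and> w \<in> ?C")
      case True
      then show ?thesis using pe w by (auto simp: sparse_part_def)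
    next
      case False
      moreover have "(u, w) \<in> prod.swap ` ?E2" if "w \<notin> ?C"
        using that wU sym [OF u w] by (intro image_eqI [of _ _ "(w, u)"]) auto
      ultimately show ?thesis using pe u w by auto
    qed
  qed
  have fE1: "finite ?E1" and fE2: "finite ?E2" using finC finUC finl by auto
  have "card (SIGMA u:U. link U F u) \<le> card (?E1 \<union> (?E2 \<union> prod.swap ` ?E2))"
    using fE1 fE2 by (intro card_mono sub) auto
  also have "\<dots> \<le> card ?E1 + (card ?E2 + card (prod.swap ` ?E2))"
    by (meson add_left_mono card_Un_le le_trans)
  also have "\<dots> \<le> card ?E1 + 2 * card ?E2"
    using card_image_le [OF fE2, of prod.swap] by linarith
  finally have "real (card (SIGMA u:U. link U F u)) \<le> real (card ?E1) + 2 * real (card ?E2)"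
    by linarith
  also have "real (card ?E1) \<le> d * N"
  proof -
    have "real (card ?E1) = (\<Sum>u\<in>?C. real (card (link U F u - linked U F R)))"
      using finC finl by (simp add: card_SigmaI)
    also have "\<dots> \<le> (\<Sum>u\<in>?C. d)" by (intro sum_mono) (auto simp: sparse_part_def)
    also have "\<dots> = card ?C * d" by simp
    also have "\<dots> \<le> N * d"
      using card_mono [OF fin CU] cU d0 by (intro mult_right_mono) auto
    finally show ?thesis by (simp add: mult.commute)
  qed
  also have "real (card ?E2) \<le> real (card (U - ?C)) * (q * D)"
  proof -
    have "real (card ?E2) = (\<Sum>u\<in>U - ?C. real (card (link U F u)))"
      using finUC finl by (simp add: card_SigmaI)
    also have "\<dots> \<le> (\<Sum>u\<in>U - ?C. real q * D)" by (intro sum_mono linkle)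
    finally show ?thesis by simp
  qed
  finally have 1: "real (card (SIGMA u:U. link U F u)) \<le> d * N + 2 * (real (card (U - ?C)) * (q * D))"
    by simp
  have "\<delta> * N / 2 * q \<le> D * real (card (SIGMA u:U. link U F u))"
    using card_link_edges_ge [OF assms(1,3)] assms(4) by simp
  also have "\<dots> \<le> D * (d * N + 2 * (real (card (U - ?C)) * (q * D)))"
    by (rule mult_left_mono [OF 1]) simp
  also have "\<dots> = q * \<delta> * N / 4 + 2 * D * (real (card (U - ?C)) * (q * D))"
    using D0 assms(6) by (simp add: field_simps)
  finally have "q * (\<delta> * N) \<le> q * (8 * D\<^sup>2 * real (card (U - ?C)))"
    by (simp add: power2_eq_square algebra_simps)
  then have "\<delta> * N \<le> 8 * D\<^sup>2 * real (card (U - ?C))"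
    using assms(5) by simp
  then have "\<delta> / (8 * D\<^sup>2) * N \<le> real (card (U - ?C))"
    using D0 by (simp add: field_simps)
  also have "real (card (U - ?C)) = real (card U) - real (card ?C)"
    using card_Diff_subset [OF finC CU] card_mono [OF fin CU] by simp
  finally show ?thesis by simp
qed

text \<open>A largest \<open>R\<close> whose members contribute \<open>d\<close> neighbours each on average
  cannot be extended, so every vertex of \<open>I\<close> has fewer than \<open>d\<close> neighbours left.\<close>

lemma independent_subset_sparse_part:
  fixes d N :: real
  assumes "U \<subseteq> V" and "real (card V) \<le> N" and "I \<subseteq> U" and "F \<subseteq> I"
    and "H \<inter> I \<times> I \<times> I = {}" and "d > 0"
  shows "\<exists>R\<subseteq>I. real (card R) \<le> N / d \<and> I \<subseteq> sparse_part U F d R"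
proof -
  have fin: "finite U" using assms finite_V finite_subset by blast
  then have finI: "finite I" using assms finite_subset by blast
  have cU: "real (card U) \<le> N"
    using card_mono [OF finite_V \<open>U \<subseteq> V\<close>] assms(2) by linarith
  define Q where "Q = {R. R \<subseteq> I \<and> real (card R) * d \<le> card (linked U F R)}"
  have "finite Q" unfolding Q_def by (rule finite_subset [of _ "Pow I"]) (use finI in auto)
  moreover have "{} \<in> Q" by (simp add: Q_def)
  ultimately obtain R where R: "R \<in> Q" and "card R = Max (card ` Q)"
    by (metis empty_iff obtains_MAX)
  then have Rmax: "\<And>R'. R' \<in> Q \<Longrightarrow> card R' \<le> card R"
    using \<open>finite Q\<close> by simp
  have RI: "R \<subseteq> I" and Rd: "real (card R) * d \<le> card (linked U F R)" using R by (auto simp: Q_def)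
  have finl: "finite (linked U F R')" for R'
    by (rule finite_subset [OF _ fin]) (auto simp: linked_def link_def)
  have "card (linked U F R) \<le> card U"
    by (rule card_mono [OF fin]) (auto simp: linked_def link_def)
  then have "real (card R) * d \<le> N" using Rd cU by linarith
  then have "real (card R) \<le> N / d" using assms(6) by (simp add: field_simps)
  moreover have "I \<subseteq> sparse_part U F d R"
  proof
    fix u assume u: "u \<in> I"
    \<comment> \<open>If \<open>u\<close> were joined to a member of \<open>R\<close> in the link
      graph, that member, \<open>u\<close> and a point of \<open>F\<close> would form a triple
      inside \<open>I\<close>.\<close>
    have "u \<notin> linked U F R"
      using u RI assms(4,5) by (auto simp: linked_def link_def)
    moreover have "real (card (link U F u - linked U F R)) < d"
    proof (rule ccontr)
      assume c: "\<not> real (card (link U F u - linked U F R)) < d"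
      have "u \<notin> R"
      proof
        assume "u \<in> R"
        then have "link U F u - linked U F R = {}" by (auto simp: linked_def)
        then have "card (link U F u - linked U F R) = 0" by (simp only: card.empty)
        then show False using c assms(6) by linarith
      qed
      then have cI: "card (insert u R) = Suc (card R)"
        using finite_subset [OF RI finI] by simp
      have "linked U F (insert u R) = (link U F u - linked U F R) \<union> linked U F R"
        by (auto simp: linked_def)
      moreover have "card \<dots> = card (link U F u - linked U F R) + card (linked U F R)"
        by (rule card_Un_disjoint) (use finl fin in \<open>auto simp: link_def\<close>)
      ultimately have "insert u R \<in> Q"
        using c cI Rd RI u by (auto simp: Q_def algebra_simps)
      then show False using Rmax cI by fastforce
    qed
    ultimately show "u \<in> sparse_part U F d R"
      using u assms(3) by (auto simp: sparse_part_def)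
  qed
  ultimately show ?thesis using RI by blast
qed

text \<open>If \<open>I\<close> has fewer than \<open>q\<close> heavy vertices, these are the
  fingerprint and all other heavy vertices are removed from \<open>U\<close>. Otherwise
  \<open>q\<close> of them form \<open>F\<close>, and the link graph supplies \<open>R\<close>. The
  leading factor 2 covers the two kinds of containers; the exponent pays for two sets, one of size
  at most \<open>q\<close> and one of size at most \<open>N / d\<close>, so a larger constant
  \<open>q\<close> makes the second one cheaper.\<close>

lemma container_step:
  fixes N \<delta> L :: real
  assumes "U \<subseteq> V" and "real (card V) \<le> N" and "0 < N" and "\<delta> > 0" and "L \<ge> 0" and "q > 0"
    and q: "real q \<le> \<delta> * N / (4 * D)"
    and "real (card (H \<inter> U \<times> U \<times> U)) \<ge> \<delta> * N\<^sup>2"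
  shows "\<exists>\<C>. finite \<C> \<and> real (card \<C>) \<le> 2 * exp (2 * exp (- L) * N + (q + 4 * D * N / (q * \<delta>)) * L)
    \<and> (\<forall>C\<in>\<C>. C \<subseteq> U \<and> real (card C) \<le> real (card U) - \<delta> / (8 * D\<^sup>2) * N)
    \<and> (\<forall>I\<subseteq>U. H \<inter> I \<times> I \<times> I = {} \<longrightarrow> (\<exists>C\<in>\<C>. I \<subseteq> C))"
proof -
  have fin: "finite U" using assms finite_V finite_subset by blast
  have D0: "real D > 0" using D_pos by simp
  define B where "B = heavy U (\<delta> * N / 2)"
  have BU: "B \<subseteq> U" by (auto simp: B_def heavy_def)
  define d where "d = q * \<delta> / (4 * D)"
  have d0: "d > 0" using assms D0 by (simp add: d_def)
  define S where "S K = {R. R \<subseteq> V \<and> real (card R) \<le> K}" for K :: real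
  have finS: "finite (S K)" for K unfolding S_def
    by (rule finite_subset [of _ "Pow V"]) (use finite_V in auto)
  have cardS: "real (card (S K)) \<le> exp (exp (- L) * N + K * L)" for K
    unfolding S_def using card_subsets_le_exp [OF finite_V assms(2,5)] .
  define \<C>0 where "\<C>0 = (\<lambda>F. (U - B) \<union> F) ` S q \<union> (\<lambda>(F, R). sparse_part U F d R) ` (S q \<times> S (N / d))"
  define \<C> where "\<C> = {C \<in> \<C>0. C \<subseteq> U \<and> real (card C) \<le> real (card U) - \<delta> / (8 * D\<^sup>2) * N}"
  have fin0: "finite \<C>0" using finS by (simp add: \<C>0_def)
  have Nd: "N / d = 4 * D * N / (q * \<delta>)" by (simp add: d_def)
  have "card \<C> \<le> card \<C>0" unfolding \<C>_def by (rule card_mono [OF fin0]) auto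
  also have "\<dots> \<le> card (S q) + card (S q) * card (S (N / d))"
    unfolding \<C>0_def card_cartesian_product [symmetric]
    by (intro order_trans [OF card_Un_le] add_mono card_image_le) (use finS in auto)
  finally have "real (card \<C>) \<le> real (card (S q)) * 1 + real (card (S q)) * real (card (S (N / d)))"
    by (simp flip: of_nat_mult of_nat_add)
  also have "\<dots> \<le> exp (exp (- L) * N + q * L) * exp (exp (- L) * N + N / d * L)
      + exp (exp (- L) * N + q * L) * exp (exp (- L) * N + N / d * L)"
    using assms d0 by (intro add_mono mult_mono cardS) auto
  also have "\<dots> = 2 * exp (2 * exp (- L) * N + (q + 4 * D * N / (q * \<delta>)) * L)"
    unfolding Nd by (simp add: algebra_simps flip: exp_add)
  finally have card: "real (card \<C>) \<le> 2 * exp (2 * exp (- L) * N + (q + 4 * D * N / (q * \<delta>)) * L)" .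
  have "\<exists>C\<in>\<C>. I \<subseteq> C" if IU: "I \<subseteq> U" and ind: "H \<inter> I \<times> I \<times> I = {}" for I
  proof (cases "card (I \<inter> B) < q")
    case True
    let ?C = "(U - B) \<union> (I \<inter> B)"
    have "?C \<in> \<C>0"
      using True BU assms(1) unfolding \<C>0_def S_def by (intro UnI1 image_eqI [OF refl]) auto
    moreover have "real (card ?C) \<le> real (card U) - \<delta> / (8 * D\<^sup>2) * N"
    proof -
      have "card ?C \<le> card (U - B) + card (I \<inter> B)" by (rule card_Un_le)
      moreover have "real (card (U - B)) = real (card U) - real (card B)"
        using card_Diff_subset [OF finite_subset [OF BU fin] BU] card_mono [OF fin BU] by simp
      moreover have "real (card B) \<ge> \<delta> * N / (2 * D)"
        unfolding B_def using card_heavy_ge [OF assms(1-4,8)] .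
      moreover have "\<delta> * N / (2 * D) = \<delta> * N / (4 * D) + \<delta> * N / (4 * D)"
        using D0 by (simp add: field_simps)
      moreover have "\<delta> / (8 * D\<^sup>2) * N \<le> \<delta> * N / (4 * D)"
      proof -
        have "\<delta> * N / (8 * D * D) \<le> \<delta> * N / (4 * D * 1)"
          using assms D0 D_pos by (intro divide_left_mono mult_mono) auto
        then show ?thesis by (simp add: power2_eq_square algebra_simps)
      qed
      ultimately show ?thesis using True q by linarith
    qed
    ultimately have "?C \<in> \<C>" using IU BU by (auto simp: \<C>_def)
    moreover have "I \<subseteq> ?C" using IU by auto
    ultimately show ?thesis by (rule bexI [rotated])
  next
    case False
    then obtain F where F: "F \<subseteq> I \<inter> B" "card F = q"
      using obtain_subset_with_card_n by (metis not_less)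
    obtain R where R: "R \<subseteq> I" "real (card R) \<le> N / d" "I \<subseteq> sparse_part U F d R"
      using independent_subset_sparse_part [OF assms(1,2) IU _ ind d0, of F] F by auto
    have "sparse_part U F d R \<in> \<C>0"
      using F R IU assms(1) unfolding \<C>0_def S_def
      by (intro UnI2 image_eqI [of _ _ "(F, R)"]) auto
    moreover have "real (card (sparse_part U F d R)) \<le> real (card U) - \<delta> / (8 * D\<^sup>2) * N"
      using F assms by (intro card_sparse_part_le) (auto simp: B_def d_def)
    moreover have "sparse_part U F d R \<subseteq> U" by (auto simp: sparse_part_def)
    ultimately show ?thesis using R by (auto simp: \<C>_def)
  qed
  moreover have "finite \<C>" using fin0 by (simp add: \<C>_def)
  ultimately show ?thesis using card unfolding \<C>_def by blast
qed

text \<open>Here \<open>j\<close> bounds the number of steps still possible, as each step removes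
  the same number of vertices. Density is measured against the fixed \<open>N\<^sup>2\<close>
  throughout, so the loss does not shrink with \<open>U\<close>. A branch that stops early is still
  charged the full power, hence the check that the base is at least 1.\<close>

lemma container_iteration:
  fixes N \<delta> L :: real
  assumes N: "real (card V) \<le> N" "0 < N" and "\<delta> > 0" and "L \<ge> 0" and "q > 0"
    and q: "real q \<le> \<delta> * N / (4 * D)"
    and "U \<subseteq> V" and "real (card U) \<le> j * (\<delta> / (8 * D\<^sup>2) * N)"
  shows "\<exists>\<C>. finite \<C> \<and>
      real (card \<C>) \<le> (2 * exp (2 * exp (- L) * N + (q + 4 * D * N / (q * \<delta>)) * L)) ^ j
    \<and> (\<forall>C\<in>\<C>. C \<subseteq> V \<and> real (card (H \<inter> C \<times> C \<times> C)) < \<delta> * N\<^sup>2)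
    \<and> (\<forall>I\<subseteq>U. H \<inter> I \<times> I \<times> I = {} \<longrightarrow> (\<exists>C\<in>\<C>. I \<subseteq> C))"
  using assms(7,8)
proof (induction j arbitrary: U)
  case 0
  have "finite U" using 0 finite_V finite_subset by blast
  then have "U = {}" using 0 by simp
  then show ?case using N assms(3) by (intro exI [of _ "{{}}"]) (simp add: zero_less_mult_iff)
next
  case (Suc j)
  let ?s = "2 * exp (2 * exp (- L) * N + (q + 4 * D * N / (q * \<delta>)) * L)"
  have s1: "?s \<ge> 1"
  proof -
    have "exp (2 * exp (- L) * N + (q + 4 * D * N / (q * \<delta>)) * L) \<ge> exp 0"
      using assms by (intro exp_le_cancel_iff [THEN iffD2] add_nonneg_nonneg mult_nonneg_nonneg) auto
    then show ?thesis unfolding exp_zero by linarith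
  qed
  show ?case
  proof (cases "real (card (H \<inter> U \<times> U \<times> U)) < \<delta> * N\<^sup>2")
    case True
    have "1 \<le> ?s ^ Suc j" by (rule one_le_power [OF s1])
    then show ?thesis using True Suc.prems by (intro exI [of _ "{U}"]) auto
  next
    case False
    then obtain \<D> where \<D>: "finite \<D>" "real (card \<D>) \<le> ?s"
      "\<And>C. C \<in> \<D> \<Longrightarrow> C \<subseteq> U \<and> real (card C) \<le> real (card U) - \<delta> / (8 * D\<^sup>2) * N"
      "\<And>I. I \<subseteq> U \<Longrightarrow> H \<inter> I \<times> I \<times> I = {} \<Longrightarrow> \<exists>C\<in>\<D>. I \<subseteq> C"
      using container_step [OF Suc.prems(1) N assms(3,4,5) q] by (metis not_less)
    have "\<exists>\<C>. finite \<C> \<and> real (card \<C>) \<le> ?s ^ j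
        \<and> (\<forall>C\<in>\<C>. C \<subseteq> V \<and> real (card (H \<inter> C \<times> C \<times> C)) < \<delta> * N\<^sup>2)
        \<and> (\<forall>I\<subseteq>W. H \<inter> I \<times> I \<times> I = {} \<longrightarrow> (\<exists>C\<in>\<C>. I \<subseteq> C))" if "W \<in> \<D>" for W
    proof (rule Suc.IH)
      show "W \<subseteq> V" using \<D>(3) [OF that] Suc.prems by blast
      have "real (Suc j) * (\<delta> / (8 * D\<^sup>2) * N) = j * (\<delta> / (8 * D\<^sup>2) * N) + \<delta> / (8 * D\<^sup>2) * N"
        by (simp only: of_nat_Suc distrib_right mult_1 add.commute)
      then show "real (card W) \<le> j * (\<delta> / (8 * D\<^sup>2) * N)"
        using \<D>(3) [OF that] Suc.prems(2) by linarith
    qed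
    then obtain G where G: "\<And>W. W \<in> \<D> \<Longrightarrow> finite (G W) \<and> real (card (G W)) \<le> ?s ^ j
        \<and> (\<forall>C\<in>G W. C \<subseteq> V \<and> real (card (H \<inter> C \<times> C \<times> C)) < \<delta> * N\<^sup>2)
        \<and> (\<forall>I\<subseteq>W. H \<inter> I \<times> I \<times> I = {} \<longrightarrow> (\<exists>C\<in>G W. I \<subseteq> C))"
      by metis
    have "real (card (\<Union>W\<in>\<D>. G W)) \<le> (\<Sum>W\<in>\<D>. real (card (G W)))"
      using card_UN_le [OF \<D>(1), of G] by (metis of_nat_le_iff of_nat_sum)
    also have "\<dots> \<le> (\<Sum>W\<in>\<D>. ?s ^ j)" by (intro sum_mono) (use G in blast)
    also have "\<dots> = real (card \<D>) * ?s ^ j" by simp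
    also have "\<dots> \<le> ?s * ?s ^ j" using \<D>(2) s1 by (intro mult_right_mono) auto
    finally have "real (card (\<Union>W\<in>\<D>. G W)) \<le> ?s ^ Suc j" by simp
    moreover have "\<exists>C\<in>(\<Union>W\<in>\<D>. G W). I \<subseteq> C" if "I \<subseteq> U" "H \<inter> I \<times> I \<times> I = {}" for I
      using \<D>(4) [OF that] G that(2) by (metis UN_I)
    moreover have "finite (\<Union>W\<in>\<D>. G W)" using \<D>(1) G by blast
    moreover have "\<forall>C\<in>(\<Union>W\<in>\<D>. G W). C \<subseteq> V \<and> real (card (H \<inter> C \<times> C \<times> C)) < \<delta> * N\<^sup>2"
      using G by blast
    ultimately show ?thesis by blast
  qed
qed

end

lemma triple_containers:
  fixes \<delta> \<epsilon> :: real and D :: nat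
  assumes "\<delta> > 0" and "\<epsilon> > 0" and "D \<ge> 1"
  shows "\<exists>N\<^sub>0. \<forall>N\<ge>N\<^sub>0. \<forall>(V :: 'a set) H. triple_system V H D \<longrightarrow> real (card V) \<le> N \<longrightarrow>
    (\<exists>\<C>. finite \<C> \<and> real (card \<C>) \<le> exp (\<epsilon> * N)
    \<and> (\<forall>C\<in>\<C>. C \<subseteq> V \<and> real (card (H \<inter> C \<times> C \<times> C)) < \<delta> * N\<^sup>2)
    \<and> (\<forall>I\<subseteq>V. H \<inter> I \<times> I \<times> I = {} \<longrightarrow> (\<exists>C\<in>\<C>. I \<subseteq> C)))"
proof -
  have D0: "real D > 0" using assms by simp
  \<comment> \<open>Order of choice: \<open>J\<close> from the loss per step; \<open>L\<close> so
    that the \<open>exp (- L)\<close> terms of all \<open>J\<close> steps cost at most a third of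
    \<open>\<epsilon> * N\<close>; \<open>q\<close> so that the sets \<open>R\<close> cost another
    third; then \<open>N0\<close> so that the part of the exponent independent of \<open>N\<close>
    fits into the last third.\<close>
  define J where "J = nat \<lceil>8 * D\<^sup>2 / \<delta>\<rceil> + 1"
  have J0: "real J > 0" by (simp add: J_def)
  have J1: "8 * D\<^sup>2 / \<delta> \<le> J" unfolding J_def by linarith
  have J2: "1 \<le> J * (\<delta> / (8 * D\<^sup>2))"
    using mult_right_mono [OF J1, of "\<delta> / (8 * D\<^sup>2)"] assms by simp
  define L where "L = max 0 (ln (6 * J / \<epsilon>))"
  have L0: "L \<ge> 0" by (simp add: L_def)
  have L1: "2 * exp (- L) * J \<le> \<epsilon> / 3"
  proof -
    have "exp (- L) \<le> exp (- ln (6 * J / \<epsilon>))" by (simp add: L_def)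
    also have "\<dots> = \<epsilon> / (6 * J)" using assms J0 by (simp add: exp_minus)
    finally show ?thesis using J0 by (simp add: field_simps)
  qed
  define q where "q = nat \<lceil>12 * D * L * J / (\<delta> * \<epsilon>)\<rceil> + 1"
  have q0: "q > 0" by (simp add: q_def)
  have "12 * D * L * J / (\<delta> * \<epsilon>) \<le> q" unfolding q_def by linarith
  then have q1: "4 * D / (q * \<delta>) * L * J \<le> \<epsilon> / 3"
    using assms q0 by (simp add: field_simps)
  define N0 where "N0 = max 1 (max (4 * D * q / \<delta>) (3 * (J * ln 2 + q * L * J) / \<epsilon>))"
  have "\<exists>\<C>. finite \<C> \<and> real (card \<C>) \<le> exp (\<epsilon> * N)
    \<and> (\<forall>C\<in>\<C>. C \<subseteq> V \<and> real (card (H \<inter> C \<times> C \<times> C)) < \<delta> * N\<^sup>2)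
    \<and> (\<forall>I\<subseteq>V. H \<inter> I \<times> I \<times> I = {} \<longrightarrow> (\<exists>C\<in>\<C>. I \<subseteq> C))"
    if N: "N \<ge> N0" and ts: "triple_system V H D" and V: "real (card V) \<le> N" for N and V :: "'a set" and H
  proof -
    interpret triple_system V H D by fact
    have N1: "N \<ge> 1" "4 * D * q / \<delta> \<le> N" "3 * (J * ln 2 + q * L * J) / \<epsilon> \<le> N"
      using N by (auto simp: N0_def)
    have "q \<le> \<delta> * N / (4 * D)" using N1(2) D0 assms by (simp add: field_simps)
    moreover have "real (card V) \<le> J * (\<delta> / (8 * D\<^sup>2) * N)"
      using V mult_right_mono [OF J2, of N] N1 by simp
    ultimately obtain \<C> where \<C>: "finite \<C>"
      "real (card \<C>) \<le> (2 * exp (2 * exp (- L) * N + (q + 4 * D * N / (q * \<delta>)) * L)) ^ J"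
      "\<forall>C\<in>\<C>. C \<subseteq> V \<and> real (card (H \<inter> C \<times> C \<times> C)) < \<delta> * N\<^sup>2"
      "\<forall>I\<subseteq>V. H \<inter> I \<times> I \<times> I = {} \<longrightarrow> (\<exists>C\<in>\<C>. I \<subseteq> C)"
      using container_iteration [OF V _ assms(1) L0 q0, of V J] N1 by auto
    note \<C>(2)
    also have "(2 * exp (2 * exp (- L) * N + (q + 4 * D * N / (q * \<delta>)) * L)) ^ J
        = exp (J * (ln 2 + (2 * exp (- L) * N + (q + 4 * D * N / (q * \<delta>)) * L)))"
      by (simp add: exp_of_nat_mult exp_add)
    also have "J * (ln 2 + (2 * exp (- L) * N + (q + 4 * D * N / (q * \<delta>)) * L))
        = (J * ln 2 + q * L * J) + 2 * exp (- L) * J * N + 4 * D / (q * \<delta>) * L * J * N"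
      by (simp add: algebra_simps)
    also have "\<dots> \<le> \<epsilon> / 3 * N + \<epsilon> / 3 * N + \<epsilon> / 3 * N"
    proof (intro add_mono mult_right_mono L1 q1)
      show "J * ln 2 + q * L * J \<le> \<epsilon> / 3 * N" using N1(3) assms by (simp add: field_simps)
    qed (use N1 in auto)
    also have "\<dots> = \<epsilon> * N" by simp
    finally have "real (card \<C>) \<le> exp (\<epsilon> * N)" by simp
    then show ?thesis using \<C> by blast
  qed
  then show ?thesis by blast
qed

subsection \<open>Counting 3-term progressions in dense sets\<close>

text \<open>Symmetric form of a progression, as \<open>triple_system\<close> requires: any of the
  three points may be the middle one. In each equation two equal points force all three to coincide,
  so \<open>x \<noteq> y\<close> makes the points pairwise distinct.\<close>

definition ap3 :: "nat \<Rightarrow> nat \<Rightarrow> nat \<Rightarrow> bool" where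
  "ap3 x y z \<longleftrightarrow> x \<noteq> y \<and> (x + z = 2 * y \<or> x + y = 2 * z \<or> y + z = 2 * x)"

lemma ap3_swap12: "ap3 x y z \<Longrightarrow> ap3 y x z"
  and ap3_swap23: "ap3 x y z \<Longrightarrow> ap3 x z y"
  by (auto simp: ap3_def)

lemma ap3_third: "{z. ap3 x y z} \<subseteq> {2 * y - x, (x + y) div 2, 2 * x - y}"
  by (auto simp: ap3_def)

lemma ap3_midpoint: "even (x + y) \<Longrightarrow> x \<noteq> y \<Longrightarrow> ap3 x y ((x + y) div 2)"
  by (auto simp: ap3_def)

lemma ap3_extension: "odd (x + y) \<Longrightarrow> x < 2 * y \<Longrightarrow> ap3 x y (2 * y - x)"
  by (auto simp: ap3_def)

text \<open>Transfers freeness from the increasing progressions of \<open>three_APs\<close> to the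
  symmetric relation; a decreasing progression is read from its other end.\<close>

lemma rainbow_3AP_free_ap3:
  assumes "rainbow_3AP_free A c" and "ap3 x y z" and "x \<in> A" "y \<in> A" "z \<in> A"
  shows "c x = c y \<or> c y = c z \<or> c x = c z"
proof -
  have *: "c u = c v \<or> c v = c w \<or> c u = c w"
    if "u + w = 2 * v" "u < v" "u \<in> A" "v \<in> A" "w \<in> A" for u v w
  proof -
    have w: "u + 2 * (v - u) = w" using that by auto
    have "\<exists>a d. (u, v, w) = (a, a + d, a + 2 * d) \<and> d \<ge> 1 \<and> a \<in> A \<and> a + d \<in> A \<and> a + 2 * d \<in> A"
      by (rule exI [of _ u], rule exI [of _ "v - u"]) (use that w in auto)
    then have "(u, v, w) \<in> three_APs A" unfolding three_APs_def by simp
    then show ?thesis using assms(1) by (auto simp: rainbow_3AP_free_def rainbow_def)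
  qed
  have **: "c u = c v \<or> c v = c w \<or> c u = c w"
    if "u + w = 2 * v" "u \<noteq> v" "u \<in> A" "v \<in> A" "w \<in> A" for u v w
  proof (cases "u < v")
    case True
    then show ?thesis using * [of u w v] that by simp
  next
    case False
    then show ?thesis using * [of w u v] that by auto
  qed
  from assms(2) consider "x + z = 2 * y" "x \<noteq> y" | "x + y = 2 * z" "x \<noteq> z" | "y + z = 2 * x" "y \<noteq> x"
    by (auto simp: ap3_def)
  then show ?thesis
    using **[of x z y] **[of x y z] **[of y z x] assms(3-5) by cases auto
qed

lemma card_parity_class_ge:
  "k div 2 \<le> card {y \<in> {a<..a + k}. even (y + s)}" for a k s :: nat
proof (induction k rule: induct_nat_012)
  case (ge2 k)
  let ?S = "\<lambda>k. {y \<in> {a<..a + k}. even (y + s)}"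
  let ?y = "if even (a + k + 1 + s) then a + k + 1 else a + k + 2"
  have "insert ?y (?S k) \<subseteq> ?S (Suc (Suc k))" by auto
  then have "card (insert ?y (?S k)) \<le> card (?S (Suc (Suc k)))" by (intro card_mono) auto
  moreover have "card (insert ?y (?S k)) = Suc (card (?S k))" by (subst card_insert_disjoint) auto
  ultimately show ?case using ge2 by simp
qed auto

lemma inj_on_midpoint: "inj_on (\<lambda>w. (x + w) div 2) {w. even (x + w)}" for x :: nat
  by (rule inj_onI) (metis add_left_cancel even_two_times_div_two mem_Collect_eq)

lemma card_avoiding_le:
  fixes n :: nat
  assumes "inj_on g S" and "g ` S \<subseteq> {1..n}"
  shows "card {w \<in> S. g w \<notin> A} \<le> card ({1..n} - A)"
  using assms by (intro card_inj_on_le [of g]) (auto intro: inj_on_subset)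

text \<open>Each gap of \<open>A\<close> excludes at most one \<open>w\<close> as the point itself
  and at most one as the midpoint, hence the factor 2. The set \<open>E\<close> lets a caller keep
  away from \<open>x\<close> and other chosen points.\<close>

lemma card_midpoints_ge:
  fixes n x :: nat
  assumes "x \<in> {1..n}"
  shows "real (card {w \<in> {1..n} - E. even (x + w) \<and> w \<in> A \<and> (x + w) div 2 \<in> A})
    \<ge> real n / 2 - 1 / 2 - card (E \<inter> {1..n}) - 2 * card ({1..n} - A)"
proof -
  let ?S = "{w \<in> {0<..0 + n}. even (w + x)}"
  let ?G = "{w \<in> {1..n} - E. even (x + w) \<and> w \<in> A \<and> (x + w) div 2 \<in> A}"
  have "?S \<subseteq> ?G \<union> ((E \<inter> {1..n}) \<union> (({1..n} - A) \<union> {w \<in> ?S. (x + w) div 2 \<notin> A}))"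
    by (auto simp: add.commute)
  then have "card ?S \<le> card (?G \<union> ((E \<inter> {1..n}) \<union> (({1..n} - A) \<union> {w \<in> ?S. (x + w) div 2 \<notin> A})))"
    by (intro card_mono) auto
  also have "\<dots> \<le> card ?G + (card (E \<inter> {1..n}) + (card ({1..n} - A) + card {w \<in> ?S. (x + w) div 2 \<notin> A}))"
    by (meson add_left_mono card_Un_le le_trans)
  also have "card {w \<in> ?S. (x + w) div 2 \<notin> A} \<le> card ({1..n} - A)"
    using assms by (intro card_avoiding_le inj_on_subset [OF inj_on_midpoint])
      (auto simp: add.commute)
  finally have "card ?S \<le> card ?G + (card (E \<inter> {1..n}) + (card ({1..n} - A) + card ({1..n} - A)))" by simp
  moreover have "n div 2 \<le> card ?S" by (rule card_parity_class_ge)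
  ultimately show ?thesis by linarith
qed

text \<open>For \<open>2 * y - x\<close> to stay in \<open>{1..n}\<close>, \<open>y\<close> ranges
  over an interval of length about n/2 above x/2, and opposite parity leaves half of it. Parity also
  excludes \<open>y = x\<close> and keeps these \<open>y\<close> apart from the points that
  \<open>card_midpoints_ge\<close> counts.\<close>

lemma card_extensions_ge:
  fixes n x :: nat
  assumes "x \<in> {1..n}"
  shows "real (card {y \<in> {1..n}. odd (x + y) \<and> x < 2 * y \<and> y \<in> A \<and> 2 * y - x \<in> A})
    \<ge> real n / 4 - 3 / 4 - 2 * card ({1..n} - A)"
proof -
  define k where "k = (x + n) div 2 - x div 2"
  let ?S = "{y \<in> {x div 2<..x div 2 + k}. even (y + (x + 1))}"
  let ?G = "{y \<in> {1..n}. odd (x + y) \<and> x < 2 * y \<and> y \<in> A \<and> 2 * y - x \<in> A}"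
  have r: "1 \<le> y \<and> y \<le> n \<and> x < 2 * y \<and> 2 * y - x \<le> n" if "y \<in> ?S" for y
    using that assms unfolding k_def by auto
  have "?S \<subseteq> ?G \<union> (({1..n} - A) \<union> {y \<in> ?S. 2 * y - x \<notin> A})"
    using r by (auto simp: add.commute)
  then have "card ?S \<le> card (?G \<union> (({1..n} - A) \<union> {y \<in> ?S. 2 * y - x \<notin> A}))"
    by (intro card_mono) auto
  also have "\<dots> \<le> card ?G + (card ({1..n} - A) + card {y \<in> ?S. 2 * y - x \<notin> A})"
    by (meson add_left_mono card_Un_le le_trans)
  also have "card {y \<in> ?S. 2 * y - x \<notin> A} \<le> card ({1..n} - A)"
  proof (rule card_avoiding_le)
    show "inj_on (\<lambda>y. 2 * y - x) ?S"
    proof (rule inj_onI)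
      fix u v assume "u \<in> ?S" "v \<in> ?S" "2 * u - x = 2 * v - x"
      then show "u = v" using r [of u] r [of v] by linarith
    qed
    show "(\<lambda>y. 2 * y - x) ` ?S \<subseteq> {1..n}"
    proof safe
      fix y assume "y \<in> {x div 2<..x div 2 + k}" "even (y + (x + 1))"
      then show "2 * y - x \<in> {1..n}" using r [of y] by auto
    qed
  qed
  finally have "card ?S \<le> card ?G + (card ({1..n} - A) + card ({1..n} - A))" by simp
  moreover have "k div 2 \<le> card ?S" by (rule card_parity_class_ge)
  moreover have "n div 2 \<le> k" unfolding k_def by linarith
  ultimately show ?thesis by linarith
qed

text \<open>The 3/4 is n/2 from midpoints for \<open>y\<close> of the parity of \<open>x\<close>,
  plus n/4 from extensions for the other parity; the gaps cost twice their number in each of the two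
  counts.\<close>

lemma card_ap3_neighbours_ge:
  fixes n x :: nat
  assumes "x \<in> {1..n}" and "A \<subseteq> {1..n}"
  shows "real (card {y \<in> A. \<exists>z\<in>A. ap3 x y z}) \<ge> 3 / 4 * real n - 4 * card ({1..n} - A) - 3"
proof -
  let ?G1 = "{w \<in> {1..n} - {x}. even (x + w) \<and> w \<in> A \<and> (x + w) div 2 \<in> A}"
  let ?G2 = "{y \<in> {1..n}. odd (x + y) \<and> x < 2 * y \<and> y \<in> A \<and> 2 * y - x \<in> A}"
  have fin: "finite A" using assms(2) finite_subset by blast
  have "?G1 \<subseteq> {y \<in> A. \<exists>z\<in>A. ap3 x y z}" using ap3_midpoint by auto
  moreover have "?G2 \<subseteq> {y \<in> A. \<exists>z\<in>A. ap3 x y z}" using ap3_extension by auto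
  ultimately have "card (?G1 \<union> ?G2) \<le> card {y \<in> A. \<exists>z\<in>A. ap3 x y z}"
    using fin by (intro card_mono) auto
  moreover have "card (?G1 \<union> ?G2) = card ?G1 + card ?G2" by (rule card_Un_disjoint) auto
  moreover have "card ({x} \<inter> {1..n}) \<le> 1" using card_mono [of "{x}" "{x} \<inter> {1..n}"] by simp
  ultimately show ?thesis
    using card_midpoints_ge [OF assms(1), of "{x}" A] card_extensions_ge [OF assms(1), of A] by linarith
qed

text \<open>At least half of the pairs in \<open>T \<times> T\<close> have equal parity, by
  convexity of the square. The diagonal costs \<open>card T\<close>, and a pair with its midpoint
  outside \<open>A\<close> is determined by \<open>x\<close> and that midpoint.\<close>

lemma card_midpoint_pairs_ge:
  fixes n :: nat
  assumes "T \<subseteq> {1..n}"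
  shows "real (card {(x, y). x \<in> T \<and> y \<in> T \<and> x \<noteq> y \<and> even (x + y) \<and> (x + y) div 2 \<in> A})
    \<ge> (real (card T))\<^sup>2 / 2 - card T - card T * card ({1..n} - A)"
proof -
  have fin: "finite T" using assms finite_subset by blast
  let ?E = "{x \<in> T. even x}" and ?O = "{x \<in> T. odd x}"
  let ?G = "{(x, y). x \<in> T \<and> y \<in> T \<and> x \<noteq> y \<and> even (x + y) \<and> (x + y) div 2 \<in> A}"
  let ?B = "{(x, y). x \<in> T \<and> y \<in> T \<and> even (x + y) \<and> (x + y) div 2 \<notin> A}"
  have finG: "finite ?G" and finB: "finite ?B"
    by (rule finite_subset [of _ "T \<times> T"]; use fin in auto)+
  have "T = ?E \<union> ?O" by auto
  moreover have "card (?E \<union> ?O) = card ?E + card ?O" by (rule card_Un_disjoint) (use fin in auto)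
  ultimately have T: "real (card T) = real (card ?E) + real (card ?O)" by simp
  have "(real (card T))\<^sup>2 / 2 \<le> (real (card ?E))\<^sup>2 + (real (card ?O))\<^sup>2"
    using zero_le_power2 [of "real (card ?E) - real (card ?O)"] unfolding T
    by (simp add: power2_eq_square algebra_simps)
  also have "\<dots> = card (?E \<times> ?E) + card (?O \<times> ?O)"
    by (simp add: power2_eq_square card_cartesian_product)
  also have "card (?E \<times> ?E) + card (?O \<times> ?O) = card (?E \<times> ?E \<union> ?O \<times> ?O)"
    by (rule card_Un_disjoint [symmetric]) (use fin in auto)
  also have "\<dots> \<le> card (?G \<union> ((\<lambda>x. (x, x)) ` T \<union> ?B))"
    using fin finG finB by (intro card_mono) auto
  also have "\<dots> \<le> card ?G + (card ((\<lambda>x. (x, x)) ` T) + card ?B)"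
    by (meson add_left_mono card_Un_le le_trans)
  also have "card ((\<lambda>x. (x, x)) ` T) \<le> card T" by (rule card_image_le [OF fin])
  also have "card ?B \<le> card (T \<times> ({1..n} - A))"
  proof (rule card_inj_on_le [of "\<lambda>(x, y). (x, (x + y) div 2)"])
    show "inj_on (\<lambda>(x, y). (x, (x + y) div 2)) ?B"
      using inj_on_midpoint by (auto simp: inj_on_def)
    show "(\<lambda>(x, y). (x, (x + y) div 2)) ` ?B \<subseteq> T \<times> ({1..n} - A)"
    proof safe
      fix x y assume xy: "x \<in> T" "y \<in> T" "(x + y) div 2 \<notin> A"
      then have "1 \<le> x" "x \<le> n" "1 \<le> y" "y \<le> n" using assms by auto
      then show "(x + y) div 2 \<in> {1..n}" by auto
    qed
  qed (use fin in auto)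
  finally show ?thesis by (simp add: card_cartesian_product)
qed

subsection \<open>Progressions in colour lists\<close>

lemma card_ge_threshold_le:
  fixes g :: "'b \<Rightarrow> real" and a S :: real
  assumes "finite X" and "(\<Sum>x\<in>X. g x) \<le> S" and "\<And>x. x \<in> X \<Longrightarrow> 0 \<le> g x" and "a > 0"
  shows "real (card {x \<in> X. a \<le> g x}) \<le> S / a"
proof -
  have "a * card {x \<in> X. a \<le> g x} = (\<Sum>x\<in>{x \<in> X. a \<le> g x}. a)" by simp
  also have "\<dots> \<le> (\<Sum>x\<in>{x \<in> X. a \<le> g x}. g x)" by (intro sum_mono) auto
  also have "\<dots> \<le> (\<Sum>x\<in>X. g x)" using assms by (intro sum_mono2) auto
  finally show ?thesis using assms by (simp add: field_simps)
qed

text \<open>By averaging, few points lie in many mixed progressions. If two of the remaining points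
  have equal parity but different values, then every \<open>w\<close> of that parity disagrees with
  one of them, giving too many mixed progressions through midpoints. Extensions then tie the two
  parity classes together. The last part needs a gap density below 1/8, whence 123/1000.\<close>

lemma almost_constant_if_few_mixed_APs:
  fixes f :: "nat \<Rightarrow> 'b" and \<sigma> :: real and n :: nat
  assumes X: "X \<subseteq> {1..n}" and m: "real (card ({1..n} - X)) \<le> 123 / 1000 * n"
    and mixed: "real (card {(x, y, z). x \<in> X \<and> y \<in> X \<and> z \<in> X \<and> ap3 x y z \<and> f x \<noteq> f y}) \<le> \<sigma> * (real n)\<^sup>2"
    and \<sigma>: "\<sigma> \<le> 1 / 1000000" and n: "n \<ge> 2000"
  shows "\<exists>x0\<in>X. real (card {x \<in> X. f x \<noteq> f x0}) \<le> 1000 * \<sigma> * n"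
proof -
  have fin: "finite X" using X finite_subset by blast
  define b where "b x = card {(y, z). y \<in> X \<and> z \<in> X \<and> ap3 x y z \<and> f x \<noteq> f y}" for x
  have finb: "finite {(y, z). y \<in> X \<and> z \<in> X \<and> ap3 x y z \<and> f x \<noteq> f y}" for x
    by (rule finite_subset [of _ "X \<times> X"]) (use fin in auto)
  define Y where "Y = {x \<in> X. real (b x) < 1 / 1000 * n}"
  have "{(x, y, z). x \<in> X \<and> y \<in> X \<and> z \<in> X \<and> ap3 x y z \<and> f x \<noteq> f y}
      = (SIGMA x:X. {(y, z). y \<in> X \<and> z \<in> X \<and> ap3 x y z \<and> f x \<noteq> f y})" by auto
  then have "(\<Sum>x\<in>X. real (b x)) \<le> \<sigma> * (real n)\<^sup>2"
    using mixed fin finb by (simp add: b_def card_SigmaI)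
  then have "real (card {x \<in> X. 1 / 1000 * n \<le> real (b x)}) \<le> \<sigma> * (real n)\<^sup>2 / (1 / 1000 * n)"
    using fin n by (intro card_ge_threshold_le) auto
  also have "{x \<in> X. 1 / 1000 * n \<le> real (b x)} = X - Y" by (auto simp: Y_def)
  also have "\<sigma> * (real n)\<^sup>2 / (1 / 1000 * n) = 1000 * \<sigma> * n"
    using n by (simp add: power2_eq_square)
  finally have XY: "real (card (X - Y)) \<le> 1000 * \<sigma> * n" .
  have "1000 * \<sigma> * n \<le> 1 / 1000 * n" using \<sigma> by (intro mult_right_mono) auto
  with XY have XY': "real (card (X - Y)) \<le> 1 / 1000 * n" by linarith
  have same: "f x = f x'" if x: "x \<in> Y" and x': "x' \<in> Y" and ev: "even (x + x')" for x x'
  proof (rule ccontr)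
    assume neq: "f x \<noteq> f x'"
    have xn: "x \<in> {1..n}" "x \<in> X" "x' \<in> X" using x x' X by (auto simp: Y_def)
    let ?G = "{w \<in> {1..n} - {x, x'}. even (x + w) \<and> w \<in> X \<and> (x + w) div 2 \<in> X}"
    let ?B = "\<lambda>x. {w \<in> X. w \<noteq> x \<and> even (x + w) \<and> (x + w) div 2 \<in> X \<and> f x \<noteq> f w}"
    let ?E = "{w \<in> {w \<in> {1..n}. even (x' + w)}. (x' + w) div 2 \<notin> X}"
    have B: "card (?B x) \<le> b x" for x
      unfolding b_def
    proof (rule card_inj_on_le [of "\<lambda>w. (w, (x + w) div 2)"])
      show "(\<lambda>w. (w, (x + w) div 2)) ` ?B x \<subseteq> {(y, z). y \<in> X \<and> z \<in> X \<and> ap3 x y z \<and> f x \<noteq> f y}"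
        using ap3_midpoint by auto
    qed (use finb in \<open>auto simp: inj_on_def\<close>)
    have "?G \<subseteq> ?B x \<union> (?B x' \<union> ?E)"
    proof
      fix w assume w: "w \<in> ?G"
      then have "even (x' + w)" using ev by auto
      then show "w \<in> ?B x \<union> (?B x' \<union> ?E)" using w neq by auto
    qed
    then have "card ?G \<le> card (?B x \<union> (?B x' \<union> ?E))" using fin by (intro card_mono) auto
    also have "\<dots> \<le> card (?B x) + (card (?B x') + card ?E)"
      by (meson add_left_mono card_Un_le le_trans)
    also have "\<dots> \<le> b x + (b x' + card ?E)" using B by (intro add_mono) auto
    also have "card ?E \<le> card ({1..n} - X)"
    proof (rule card_avoiding_le)
      have "x' \<in> {1..n}" using X xn by blast
      then show "(\<lambda>w. (x' + w) div 2) ` {w \<in> {1..n}. even (x' + w)} \<subseteq> {1..n}"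
        by (auto simp del: even_add)
    qed (rule inj_on_subset [OF inj_on_midpoint], auto)
    finally have "card ?G \<le> b x + (b x' + card ({1..n} - X))" by simp
    moreover have "card ({x, x'} \<inter> {1..n}) \<le> 2"
      using card_mono [of "{x, x'}" "{x, x'} \<inter> {1..n}"] card_insert_le_m1 [of 2 "{x'}" x] by simp
    moreover have "real (b x) < 1 / 1000 * n" "real (b x') < 1 / 1000 * n" using x x' by (auto simp: Y_def)
    ultimately show False
      using card_midpoints_ge [OF xn(1), of "{x, x'}" X] m n by linarith
  qed
  have other: "\<exists>y\<in>Y. odd (x + y) \<and> f x = f y" if x: "x \<in> Y" for x
  proof (rule ccontr)
    assume no: "\<not> (\<exists>y\<in>Y. odd (x + y) \<and> f x = f y)"
    have xn: "x \<in> {1..n}" "x \<in> X" using x X by (auto simp: Y_def)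
    let ?G = "{y \<in> {1..n}. odd (x + y) \<and> x < 2 * y \<and> y \<in> X \<and> 2 * y - x \<in> X}"
    let ?B = "{y \<in> ?G. f x \<noteq> f y}"
    have "card ?B \<le> b x"
      unfolding b_def
    proof (rule card_inj_on_le [of "\<lambda>y. (y, 2 * y - x)"])
      show "(\<lambda>y. (y, 2 * y - x)) ` ?B \<subseteq> {(y, z). y \<in> X \<and> z \<in> X \<and> ap3 x y z \<and> f x \<noteq> f y}"
        using ap3_extension by auto
    qed (use finb in \<open>auto simp: inj_on_def\<close>)
    moreover have "?G \<subseteq> ?B \<union> (X - Y)" using no by auto
    then have "card ?G \<le> card (?B \<union> (X - Y))" using fin by (intro card_mono) auto
    then have "card ?G \<le> card ?B + card (X - Y)" by (meson card_Un_le le_trans)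
    moreover have "real (b x) < 1 / 1000 * n" using x by (auto simp: Y_def)
    ultimately show False
      using card_extensions_ge [OF xn(1), of X] m n XY' by linarith
  qed
  have "Y \<noteq> {}"
  proof
    assume "Y = {}"
    then have "real (card X) \<le> 1 / 1000 * n" using XY' by simp
    moreover have "card ({1..n} - X) = n - card X" using card_Diff_subset [OF fin X] by simp
    ultimately show False using m n by linarith
  qed
  then obtain x0 where x0: "x0 \<in> Y" by blast
  obtain y0 where y0: "y0 \<in> Y" "odd (x0 + y0)" "f x0 = f y0" using other [OF x0] by blast
  have "f x = f x0" if "x \<in> Y" for x
  proof (cases "even (x + x0)")
    case True
    then show ?thesis using same that x0 by blast
  next
    case False
    then have "even (x + y0)" using y0 by auto
    then show ?thesis using same that y0 by metis
  qed
  then have "{x \<in> X. f x \<noteq> f x0} \<subseteq> X - Y" by auto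
  then have "card {x \<in> X. f x \<noteq> f x0} \<le> card (X - Y)" using fin by (intro card_mono) auto
  moreover have "x0 \<in> X" using x0 by (simp add: Y_def)
  ultimately show ?thesis using XY by (meson le_trans of_nat_le_iff order_trans)
qed

section \<open>Rainbow choices from colour lists on a progression\<close>

definition rainbow_aps :: "nat set \<Rightarrow> (nat \<Rightarrow> 'c set) \<Rightarrow> (nat \<times> nat \<times> nat) set" where
  "rainbow_aps A P = {(x, y, z). x \<in> A \<and> y \<in> A \<and> z \<in> A \<and> ap3 x y z \<and>
     (\<exists>i\<in>P x. \<exists>j\<in>P y. \<exists>k\<in>P z. i \<noteq> j \<and> j \<noteq> k \<and> i \<noteq> k)}"

text \<open>Greedy choice, starting with the list that may be smallest.\<close>

lemma distinct_choice_large: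
  assumes "card X \<ge> 3" and "card Y \<ge> 2" and "Z \<noteq> {}"
  shows "\<exists>i\<in>X. \<exists>j\<in>Y. \<exists>k\<in>Z. i \<noteq> j \<and> j \<noteq> k \<and> i \<noteq> k"
proof -
  obtain k where "k \<in> Z" using assms by blast
  moreover have "\<not> Y \<subseteq> {k}" using assms(2) card_mono [of "{k}" Y] by auto
  then obtain j where "j \<in> Y" "j \<noteq> k" by blast
  moreover have "\<not> X \<subseteq> {j, k}"
    using assms(1) card_mono [of "{j, k}" X] card_insert_le_m1 [of 2 "{k}" j] by auto
  then obtain i where "i \<in> X" "i \<noteq> j" "i \<noteq> k" by blast
  ultimately show ?thesis by blast
qed

text \<open>Take \<open>i\<close> only in \<open>X\<close> and \<open>j\<close> only in
  \<open>Y\<close>. A further colour in \<open>Z\<close> finishes; otherwise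
  \<open>Z = {i, j}\<close>, and the second colour of \<open>X\<close>, then \<open>j\<close>, then
  \<open>i\<close> is a rainbow choice.\<close>

lemma distinct_choice_pairs:
  assumes "card X = 2" and "card Y = 2" and "card Z = 2" and "X \<noteq> Y"
  shows "\<exists>i\<in>X. \<exists>j\<in>Y. \<exists>k\<in>Z. i \<noteq> j \<and> j \<noteq> k \<and> i \<noteq> k"
proof -
  have fin: "finite X" "finite Y" "finite Z" using assms card.infinite by fastforce+
  have "\<not> X \<subseteq> Y" "\<not> Y \<subseteq> X" using assms fin card_subset_eq by metis+
  then obtain i j where ij: "i \<in> X" "i \<notin> Y" "j \<in> Y" "j \<notin> X" by blast
  show ?thesis
  proof (cases "Z \<subseteq> {i, j}")
    case True
    have "card {i, j} = 2" using ij by (auto simp: card_2_iff)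
    then have "Z = {i, j}" using True assms by (intro card_subset_eq) auto
    have "\<not> X \<subseteq> {i}" using assms(1) card_mono [of "{i}" X] by auto
    then obtain i' where "i' \<in> X" "i' \<noteq> i" by blast
    moreover have "i \<in> Z" using \<open>Z = {i, j}\<close> by simp
    moreover have "i' \<noteq> j" "j \<noteq> i" using ij \<open>i' \<in> X\<close> by auto
    ultimately show ?thesis using ij(3) by blast
  next
    case False
    then obtain k where "k \<in> Z" "k \<noteq> i" "k \<noteq> j" by blast
    moreover have "i \<noteq> j" using ij by auto
    ultimately show ?thesis using ij(1,3) by metis
  qed
qed

lemma finite_rainbow_aps: "finite A \<Longrightarrow> finite (rainbow_aps A P)"
  by (rule finite_subset [of _ "A \<times> A \<times> A"]) (auto simp: rainbow_aps_def)

text \<open>With a list of size at least 3 at \<open>x\<close>, an AP through \<open>x\<close> can only avoid a rainbow choice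
  if its other two lists are singletons. So many such \<open>x\<close> force many singletons; and since
  such \<open>x\<close> rarely share an AP, there can be at most about twice as many as gaps in \<open>A\<close>.\<close>

lemma large_lists_bounds:
  fixes P :: "nat \<Rightarrow> 'c set" and n :: nat
  assumes A: "A \<subseteq> {1..n}" and ne: "\<And>x. x \<in> A \<Longrightarrow> P x \<noteq> {}"
    and T: "T = {x \<in> A. card (P x) \<ge> 3}" and Z: "Z = {x \<in> A. card (P x) \<ge> 2}"
    and t: "real (card T) \<ge> s" "s > 0"
  shows "real (card T) \<le> 2 * card ({1..n} - A) + 2 + 2 * card (rainbow_aps A P) / s"
    and "real (card Z) \<le> n / 4 + 3 * card ({1..n} - A) + 3 + card (rainbow_aps A P) / s"
proof -
  let ?m = "card ({1..n} - A)" and ?b = "card (rainbow_aps A P)"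
  have fin: "finite A" using A finite_subset by blast
  have TA: "T \<subseteq> A" and ZA: "Z \<subseteq> A" using T Z by auto
  have finT: "finite T" using TA fin finite_subset by blast
  have bad: "(x, y, z) \<in> rainbow_aps A P" if "x \<in> T" "y \<in> Z" "z \<in> A" "ap3 x y z" for x y z
    using that distinct_choice_large [of "P x" "P y" "P z"] ne by (auto simp: rainbow_aps_def T Z)
  have t0: "real (card T) > 0" using t by linarith
  have div: "real ?b / card T \<le> ?b / s" using t t0 by (intro divide_left_mono) auto
  let ?Q = "{(x, y). x \<in> T \<and> y \<in> T \<and> x \<noteq> y \<and> even (x + y) \<and> (x + y) div 2 \<in> A}"
  have "card ?Q \<le> ?b"
  proof (rule card_inj_on_le [of "\<lambda>(x, y). (x, y, (x + y) div 2)"])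
    show "(\<lambda>(x, y). (x, y, (x + y) div 2)) ` ?Q \<subseteq> rainbow_aps A P"
    proof (rule image_subsetI)
      fix p assume "p \<in> ?Q"
      then obtain x y where "p = (x, y)" "x \<in> T" "y \<in> T" "x \<noteq> y" "even (x + y)" "(x + y) div 2 \<in> A"
        by blast
      then show "(case p of (x, y) \<Rightarrow> (x, y, (x + y) div 2)) \<in> rainbow_aps A P"
        using bad [of x y] ap3_midpoint [of x y] by (simp add: T Z)
    qed
  qed (use finite_rainbow_aps [OF fin] in \<open>auto simp: inj_on_def\<close>)
  moreover have "T \<subseteq> {1..n}" using TA A by blast
  ultimately have "(real (card T))\<^sup>2 / 2 - card T - card T * ?m \<le> ?b"
    using card_midpoint_pairs_ge [of T n A] by linarith
  then have "real (card T) * (real (card T) / 2 - 1 - ?m) \<le> ?b"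
    by (simp add: power2_eq_square algebra_simps)
  then have "real (card T) / 2 - 1 - ?m \<le> ?b / card T"
    using t0 by (simp add: field_simps)
  then show "real (card T) \<le> 2 * ?m + 2 + 2 * ?b / s" using div by simp
  define g where "g x = card {y \<in> Z. \<exists>z\<in>A. ap3 x y z}" for x
  \<comment> \<open>Averaging: each pair counted by the sum of \<open>g\<close> over
    \<open>T\<close> consists of the first two points of a rainbow progression, so the sum is at
    most \<open>?b\<close>.\<close>
  have "\<exists>x\<in>T. real (g x) \<le> ?b / card T"
  proof (rule ccontr)
    assume "\<not> ?thesis"
    then have "(\<Sum>x\<in>T. real ?b / card T) < (\<Sum>x\<in>T. real (g x))"
      using finT t0 by (intro sum_strict_mono) (auto simp: not_le)
    also have "\<dots> = card (SIGMA x:T. {y \<in> Z. \<exists>z\<in>A. ap3 x y z})"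
      using finT finite_subset [OF ZA fin] by (subst card_SigmaI) (auto simp: g_def)
    also have "\<dots> \<le> card ((\<lambda>(x, y, z). (x, y)) ` rainbow_aps A P)"
      using bad finite_rainbow_aps [OF fin] by (intro of_nat_mono card_mono) force+
    also have "\<dots> \<le> ?b" using card_image_le [OF finite_rainbow_aps [OF fin]] by (intro of_nat_mono)
    finally show False using t0 by simp
  qed
  then obtain x where x: "x \<in> T" "real (g x) \<le> ?b / card T" by blast
  let ?N = "{y \<in> A. \<exists>z\<in>A. ap3 x y z}"
  \<comment> \<open>Apart from \<open>g x\<close> points, \<open>Z\<close> lies among the points of
    \<open>A\<close> that share no progression with \<open>x\<close>. With m gaps there are at most
    (n - m) - (3n/4 - 4m - 3) = n/4 + 3m + 3 of those.\<close>
  have "Z \<subseteq> {y \<in> Z. \<exists>z\<in>A. ap3 x y z} \<union> (A - ?N)" using ZA by auto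
  then have "card Z \<le> card ({y \<in> Z. \<exists>z\<in>A. ap3 x y z} \<union> (A - ?N))"
    using fin finite_subset [OF ZA fin] by (intro card_mono) auto
  also have "\<dots> \<le> g x + card (A - ?N)" unfolding g_def by (rule card_Un_le)
  finally have "real (card Z) \<le> g x + real (card (A - ?N))" by simp
  moreover have "real (card (A - ?N)) = real (card A) - real (card ?N)"
    using fin card_mono [of A ?N] by (subst card_Diff_subset) auto
  moreover have "real (card A) = n - real ?m"
    using card_Diff_subset [OF fin A] card_mono [OF _ A] by simp
  moreover have "real (card ?N) \<ge> 3 / 4 * real n - 4 * ?m - 3"
    using x TA A by (intro card_ap3_neighbours_ge) auto
  ultimately show "real (card Z) \<le> n / 4 + 3 * ?m + 3 + ?b / s"
    using x(2) div by simp
qed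

section \<open>The numerical threshold and the dichotomy for list assignments\<close>

lemma log_ge_if_ge_3:
  fixes r :: nat
  assumes "r \<ge> 3"
  shows "11 / 7 \<le> log 2 (real r)"
proof -
  have "2 powr (11 / 7) \<le> (3::real)"
  proof -
    \<comment> \<open>The fraction 11/7 comes from 2048 = 2 ^ 11 \<le> 3 ^ 7 = 2187.\<close>
    have "(2 powr (11 / 7)) ^ 7 = (2::real) ^ 11" by (simp add: powr_power)
    also have "\<dots> \<le> 3 ^ 7" by simp
    finally show ?thesis by (rule power_mono_iff [THEN iffD1, rotated -1]) auto
  qed
  also have "\<dots> \<le> real r" using assms by simp
  finally show ?thesis using assms by (subst le_log_iff) auto
qed

text \<open>The value is 21/179 rounded up. It lies below 1/8 with enough margin to treat a small
  proportion of exceptional points as additional gaps.\<close>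

lemma threshold_le:
  fixes r :: nat
  assumes "r \<ge> 3"
  shows "3 / (13 + 8 * log 2 (real r)) \<le> 1174 / 10000"
proof -
  have "3 / (13 + 8 * log 2 (real r)) \<le> 3 / (13 + 8 * (11 / 7))"
    using log_ge_if_ge_3 [OF assms] by (intro divide_left_mono) auto
  then show ?thesis by simp
qed

text \<open>The order of quantifiers matters: \<open>\<theta>\<close> is dictated by the count of
  nearly two-coloured colorings, whereas \<open>\<gamma>\<close> is produced before any container
  exists, so that the number of containers can later be made small against it.\<close>

lemma template_dichotomy:
  fixes r :: nat and \<xi> \<theta> :: real
  assumes r: "r \<ge> 3" and \<xi>: "0 < \<xi>" "\<xi> \<le> 3 / (13 + 8 * log 2 (real r))" and \<theta>: "\<theta> > 0"
  shows "\<exists>\<gamma>>0. \<exists>\<delta>>0. \<exists>n\<^sub>0::nat. \<forall>n\<ge>n\<^sub>0. \<forall>A (P :: nat \<Rightarrow> 'c set).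
    A \<subseteq> {1..n} \<longrightarrow> real (card A) \<ge> (1 - \<xi>) * n \<longrightarrow>
    (\<forall>x\<in>A. P x \<noteq> {} \<and> finite (P x) \<and> card (P x) \<le> r) \<longrightarrow>
    real (card (rainbow_aps A P)) \<le> \<delta> * (real n)\<^sup>2 \<longrightarrow>
    (\<Prod>x\<in>A. real (card (P x))) \<le> 2 powr ((1 - \<gamma>) * n) \<or>
    (\<exists>x0\<in>A. card (P x0) = 2 \<and> real (card {x \<in> A. P x \<noteq> P x0}) \<le> \<theta> * n)"
proof -
  define l where "l = log 2 (real r)"
  have l: "11 / 7 \<le> l" unfolding l_def by (rule log_ge_if_ge_3 [OF r])
  have \<xi>1: "\<xi> \<le> 3 / (13 + 8 * l)" using \<xi> by (simp add: l_def)
  have \<xi>2: "\<xi> \<le> 1174 / 10000" using \<xi>(2) threshold_le [OF r] by linarith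
  \<comment> \<open>The room left by the bound on \<open>\<xi>\<close>: in the case of many large
    lists the main terms of the exponent sum to at most (1 - g) * n.\<close>
  define g where "g = 3 / 4 - \<xi> * (2 * l + 3)"
  have g0: "g > 0"
  proof -
    have "\<xi> * (2 * l + 3) \<le> 3 / (13 + 8 * l) * (2 * l + 3)" using \<xi>1 l by (intro mult_right_mono) auto
    also have "\<dots> < 3 / 4" using l by (simp add: field_simps)
    finally show ?thesis by (simp add: g_def)
  qed
  \<comment> \<open>\<open>\<beta> * n\<close> singletons count as many. \<open>\<alpha>\<close>
    makes fewer than \<open>\<alpha> * n\<close> large lists cost at most half of what those
    singletons save, and \<open>\<delta>\<close> is small against \<open>\<alpha> * g\<close>. The
    thirds of \<open>\<theta>\<close> go to \<open>\<alpha>\<close>, \<open>\<beta>\<close> and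
    \<open>1000 * \<delta>\<close>.\<close>
  define \<beta> where "\<beta> = min (\<theta> / 3) (1 / 1000)"
  define \<alpha> where "\<alpha> = \<beta> / (2 * l)"
  have \<beta>: "\<beta> > 0" "\<beta> \<le> \<theta> / 3" "\<beta> \<le> 1 / 1000" using \<theta> by (auto simp: \<beta>_def)
  have \<alpha>: "\<alpha> > 0" "\<alpha> * l = \<beta> / 2" using \<beta> l by (auto simp: \<alpha>_def)
  have \<alpha>\<beta>: "\<alpha> \<le> \<beta>"
  proof -
    have "\<beta> / (2 * l) \<le> \<beta> / 1" using \<beta> l by (intro divide_left_mono) auto
    then show ?thesis by (simp add: \<alpha>_def)
  qed
  define \<delta> where "\<delta> = min (min (1 / 1000000) (\<theta> / 3000)) (\<alpha> * g / (8 * l))"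
  have \<delta>: "\<delta> > 0" "\<delta> \<le> 1 / 1000000" "1000 * \<delta> \<le> \<theta> / 3" "\<delta> \<le> \<alpha> * g / (8 * l)"
    using \<theta> \<alpha> g0 l by (auto simp: \<delta>_def)
  have \<delta>\<alpha>: "(2 * l + 1) * (\<delta> / \<alpha>) \<le> 3 / 8 * g"
  proof -
    have "\<delta> / \<alpha> \<le> g / (8 * l)" using \<delta>(4) \<alpha> l by (simp add: field_simps)
    then have "(2 * l + 1) * (\<delta> / \<alpha>) \<le> (3 * l) * (g / (8 * l))"
      using l \<delta> \<alpha> by (intro mult_mono) auto
    also have "\<dots> = 3 / 8 * g" using l by simp
    finally show ?thesis .
  qed
  define \<gamma> where "\<gamma> = min (\<beta> / 2) (3 / 8 * g)"
  have \<gamma>: "\<gamma> > 0" "\<gamma> \<le> \<beta> / 2" "\<gamma> \<le> 3 / 8 * g" using \<beta> g0 by (auto simp: \<gamma>_def)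
  define n0 where "n0 = nat \<lceil>max 2000 (4 * (2 * l + 3) / g)\<rceil>"
  have main: "(\<Prod>x\<in>A. real (card (P x))) \<le> 2 powr ((1 - \<gamma>) * n) \<or>
    (\<exists>x0\<in>A. card (P x0) = 2 \<and> real (card {x \<in> A. P x \<noteq> P x0}) \<le> \<theta> * n)"
    if n: "n \<ge> n0" and A: "A \<subseteq> {1..n}" and cA: "real (card A) \<ge> (1 - \<xi>) * n"
      and P: "\<And>x. x \<in> A \<Longrightarrow> P x \<noteq> {} \<and> finite (P x) \<and> card (P x) \<le> r"
      and bad: "real (card (rainbow_aps A P)) \<le> \<delta> * (real n)\<^sup>2"
    for n A and P :: "nat \<Rightarrow> 'c set"
  proof -
    have "real n \<ge> max 2000 (4 * (2 * l + 3) / g)" using n unfolding n0_def by linarith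
    then have n1: "real n \<ge> 2000" "4 * (2 * l + 3) / g \<le> n" by auto
    then have n2: "2 * l + 3 \<le> g / 4 * n" using g0 by (simp add: field_simps)
    have fin: "finite A" using A finite_subset by blast
    let ?m = "card ({1..n} - A)"
    have mA: "real ?m = n - real (card A)"
      using card_Diff_subset [OF fin A] card_mono [OF _ A] by simp
    then have m: "real ?m \<le> \<xi> * n" using cA by (simp add: algebra_simps)
    define T where "T = {x \<in> A. card (P x) \<ge> 3}"
    define Z where "Z = {x \<in> A. card (P x) \<ge> 2}"
    have TA: "T \<subseteq> A" and ZA: "Z \<subseteq> A" by (auto simp: T_def Z_def)
    \<comment> \<open>As \<open>T\<close> is part of \<open>Z\<close>, a list of size at least 3 is
      charged \<open>2 * r\<close> and a list of size 2 is charged 2.\<close>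
    have "(\<Prod>x\<in>A. real (card (P x))) \<le> (\<Prod>x\<in>A. (if x \<in> T then real r else 1) * (if x \<in> Z then 2 else 1))"
    proof (intro prod_mono conjI)
      fix x assume x: "x \<in> A"
      show "real (card (P x)) \<le> (if x \<in> T then real r else 1) * (if x \<in> Z then 2 else 1)"
      proof (cases "card (P x) \<ge> 3")
        case True
        have "real (card (P x)) \<le> real r * 1" using P [OF x] by simp
        also have "\<dots> \<le> real r * 2" by (rule mult_left_mono) auto
        finally show ?thesis using True x by (simp add: T_def Z_def)
      next
        case False
        then show ?thesis using x by (auto simp: T_def Z_def)
      qed
    qed simp
    also have "\<dots> = real r ^ card T * 2 ^ card Z"
      using fin TA ZA by (simp add: prod.distrib prod.If_cases Int_absorb1)
    also have "\<dots> = 2 powr (l * card T + card Z)"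
    proof -
      have "real r = 2 powr l" using r by (simp add: l_def)
      then show ?thesis by (simp add: powr_add powr_realpow [symmetric] powr_powr mult.commute)
    qed
    finally have W: "(\<Prod>x\<in>A. real (card (P x))) \<le> 2 powr (l * card T + card Z)" .
    have W': "(\<Prod>x\<in>A. real (card (P x))) \<le> 2 powr ((1 - \<gamma>) * n)"
      if "l * card T + card Z \<le> (1 - \<gamma>) * n"
      using W that by (meson order_trans powr_mono one_le_numeral)
    consider "real (card T) \<ge> \<alpha> * n" | "real (card T) < \<alpha> * n" "real (card (A - Z)) \<ge> \<beta> * n"
      | "real (card T) < \<alpha> * n" "real (card (A - Z)) < \<beta> * n" by linarith
    then show ?thesis
    proof cases
      case 1
      have an: "\<alpha> * n > 0" using \<alpha> n1 by simp
      have "card (rainbow_aps A P) / (\<alpha> * n) \<le> \<delta> * (real n)\<^sup>2 / (\<alpha> * n)"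
        using bad an by (intro divide_right_mono) auto
      also have "\<dots> = \<delta> / \<alpha> * n" using n1 by (simp add: power2_eq_square)
      finally have b: "card (rainbow_aps A P) / (\<alpha> * n) \<le> \<delta> / \<alpha> * n" .
      have "real (card T) \<le> 2 * ?m + 2 + 2 * card (rainbow_aps A P) / (\<alpha> * n)"
        using large_lists_bounds(1) [OF A _ T_def Z_def 1 an] P by blast
      also have "\<dots> \<le> 2 * ?m + 2 + 2 * (\<delta> / \<alpha> * n)" using b by simp
      finally have t: "l * card T \<le> l * (2 * ?m + 2 + 2 * (\<delta> / \<alpha> * n))"
        using l by (intro mult_left_mono) auto
      have "real (card Z) \<le> n / 4 + 3 * ?m + 3 + card (rainbow_aps A P) / (\<alpha> * n)"
        using large_lists_bounds(2) [OF A _ T_def Z_def 1 an] P by blast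
      then have "l * card T + card Z \<le> l * (2 * ?m + 2 + 2 * (\<delta> / \<alpha> * n)) + (n / 4 + 3 * ?m + 3 + \<delta> / \<alpha> * n)"
        using t b by linarith
      also have "\<dots> = n / 4 + ?m * (2 * l + 3) + (2 * l + 1) * (\<delta> / \<alpha>) * n + (2 * l + 3)"
        by (simp add: algebra_simps)
      \<comment> \<open>The rainbow progressions and the additive constants use 3/8 and 2/8 of the
        room \<open>g\<close>, so 3/8 of it remains as saving.\<close>
      also have "\<dots> \<le> n / 4 + \<xi> * n * (2 * l + 3) + 3 / 8 * g * n + g / 4 * n"
        using m l n2 \<delta>\<alpha> by (intro add_mono mult_right_mono) auto
      also have "\<xi> * n * (2 * l + 3) = (3 / 4 - g) * n"
        by (simp add: g_def algebra_simps)
      also have "n / 4 + (3 / 4 - g) * n + 3 / 8 * g * n + g / 4 * n = (1 - 3 / 8 * g) * n"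
        by (simp add: algebra_simps)
      also have "\<dots> \<le> (1 - \<gamma>) * n" using \<gamma> by (intro mult_right_mono) auto
      finally show ?thesis using W' by blast
    next
      case 2
      have "real (card Z) = card A - real (card (A - Z))"
        using fin ZA card_mono [OF fin ZA] by (simp add: card_Diff_subset finite_subset)
      also have "\<dots> \<le> n - \<beta> * n" using 2 mA by linarith
      finally have "real (card Z) \<le> n - \<beta> * n" .
      moreover have "l * card T \<le> \<beta> / 2 * n"
      proof -
        have "l * card T \<le> l * (\<alpha> * n)" using 2 l by (intro mult_left_mono) auto
        also have "\<dots> = (\<alpha> * l) * n" by simp
        also have "\<dots> = \<beta> / 2 * n" by (simp only: \<alpha>(2))
        finally show ?thesis .
      qed
      ultimately have "l * card T + card Z \<le> (1 - \<beta> / 2) * n" by (simp add: left_diff_distrib)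
      also have "\<dots> \<le> (1 - \<gamma>) * n" using \<gamma> by (intro mult_right_mono) auto
      finally show ?thesis using W' by blast
    next
      case 3
      define X where "X = {x \<in> A. card (P x) = 2}"
      have X: "X \<subseteq> {1..n}" "X \<subseteq> A" using A by (auto simp: X_def)
      have "A - X \<subseteq> T \<union> (A - Z)" by (auto simp: X_def T_def Z_def)
      then have "card (A - X) \<le> card (T \<union> (A - Z))" using fin TA finite_subset by (intro card_mono) auto
      also have "\<dots> \<le> card T + card (A - Z)" by (rule card_Un_le)
      finally have AX: "real (card (A - X)) \<le> \<alpha> * n + \<beta> * n" using 3 by linarith
      have "{1..n} - X \<subseteq> ({1..n} - A) \<union> (A - X)" by auto
      then have "card ({1..n} - X) \<le> card (({1..n} - A) \<union> (A - X))" using fin by (intro card_mono) auto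
      also have "\<dots> \<le> ?m + card (A - X)" by (rule card_Un_le)
      finally have "real (card ({1..n} - X)) \<le> \<xi> * n + (\<alpha> * n + \<beta> * n)" using m AX by linarith
      also have "\<dots> = (\<xi> + \<alpha> + \<beta>) * n" by (simp add: algebra_simps)
      also have "\<dots> \<le> 123 / 1000 * n" using \<xi>2 \<alpha>\<beta> \<beta> by (intro mult_right_mono) auto
      finally have cX: "real (card ({1..n} - X)) \<le> 123 / 1000 * n" .
      have "{(x, y, z). x \<in> X \<and> y \<in> X \<and> z \<in> X \<and> ap3 x y z \<and> P x \<noteq> P y} \<subseteq> rainbow_aps A P"
      proof
        fix p assume "p \<in> {(x, y, z). x \<in> X \<and> y \<in> X \<and> z \<in> X \<and> ap3 x y z \<and> P x \<noteq> P y}"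
        then obtain x y z where p: "p = (x, y, z)"
          and xyz: "x \<in> X" "y \<in> X" "z \<in> X" "ap3 x y z" "P x \<noteq> P y" by blast
        then have "\<exists>i\<in>P x. \<exists>j\<in>P y. \<exists>k\<in>P z. i \<noteq> j \<and> j \<noteq> k \<and> i \<noteq> k"
          by (intro distinct_choice_pairs) (auto simp: X_def)
        then show "p \<in> rainbow_aps A P" using p xyz X by (simp add: rainbow_aps_def subset_iff)
      qed
      then have "card {(x, y, z). x \<in> X \<and> y \<in> X \<and> z \<in> X \<and> ap3 x y z \<and> P x \<noteq> P y} \<le> card (rainbow_aps A P)"
        by (intro card_mono finite_rainbow_aps fin)
      then have "real (card {(x, y, z). x \<in> X \<and> y \<in> X \<and> z \<in> X \<and> ap3 x y z \<and> P x \<noteq> P y}) \<le> \<delta> * (real n)\<^sup>2"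
        using bad by linarith
      moreover have "n \<ge> 2000" using n1 by linarith
      ultimately obtain x0 where x0: "x0 \<in> X" "real (card {x \<in> X. P x \<noteq> P x0}) \<le> 1000 * \<delta> * n"
        using almost_constant_if_few_mixed_APs [OF X(1) cX _ \<delta>(2), of P] by blast
      have "{x \<in> A. P x \<noteq> P x0} \<subseteq> (A - X) \<union> {x \<in> X. P x \<noteq> P x0}" by auto
      then have "card {x \<in> A. P x \<noteq> P x0} \<le> card ((A - X) \<union> {x \<in> X. P x \<noteq> P x0})"
        using fin finite_subset [OF X(2) fin] by (intro card_mono) auto
      also have "\<dots> \<le> card (A - X) + card {x \<in> X. P x \<noteq> P x0}" by (rule card_Un_le)
      finally have "real (card {x \<in> A. P x \<noteq> P x0}) \<le> \<alpha> * n + \<beta> * n + 1000 * \<delta> * n" using x0 AX by linarith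
      also have "\<dots> = (\<alpha> + \<beta> + 1000 * \<delta>) * n" by (simp add: algebra_simps)
      also have "\<dots> \<le> \<theta> * n" using \<alpha>\<beta> \<beta> \<delta> by (intro mult_right_mono) auto
      finally show ?thesis using x0 X by (auto simp: X_def)
    qed
  qed
  show ?thesis
    by (rule exI [of _ \<gamma>], rule conjI [OF \<gamma>(1)], rule exI [of _ \<delta>], rule conjI [OF \<delta>(1)],
        rule exI [of _ n0], intro allI impI, rule main) auto
qed

subsection \<open>Colorings with few exceptions to two colours\<close>

lemma finite_colorings: "finite A \<Longrightarrow> finite (colorings r A)"
  by (simp add: colorings_def finite_PiE)

lemma exp_le_two_powr: "x \<ge> 0 \<Longrightarrow> exp x \<le> 2 powr (2 * x)" for x :: real
proof -
  assume "x \<ge> 0"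
  have "(1 / 2 :: real) \<le> ln 2" using ln_le_minus_one [of "1 / 2 :: real"] by (simp add: ln_div)
  then have "2 * x * ln 2 \<ge> 2 * x * (1 / 2)" using \<open>x \<ge> 0\<close> by (intro mult_left_mono) auto
  then show ?thesis by (simp add: powr_def)
qed

lemma card_two_colored_le:
  assumes "finite A" and "r \<ge> 2"
  shows "card {c \<in> colorings r A. card (c ` A) \<le> 2} \<le> (r choose 2) * 2 ^ card A"
proof -
  let ?\<S> = "{S. S \<subseteq> {1..r} \<and> card S = 2}"
  have finS: "finite ?\<S>" by simp
  have fin: "finite S" if "S \<in> ?\<S>" for S using that finite_subset by auto
  have "{c \<in> colorings r A. card (c ` A) \<le> 2} \<subseteq> (\<Union>S\<in>?\<S>. A \<rightarrow>\<^sub>E S)"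
  proof
    fix c assume c: "c \<in> {c \<in> colorings r A. card (c ` A) \<le> 2}"
    then have "c ` A \<subseteq> {1..r}" by (auto simp: colorings_def)
    then obtain S where "c ` A \<subseteq> S" "S \<subseteq> {1..r}" "card S = 2"
      using exists_subset_between [of "c ` A" 2 "{1..r}"] c assms by auto
    then show "c \<in> (\<Union>S\<in>?\<S>. A \<rightarrow>\<^sub>E S)" using c by (auto simp: colorings_def PiE_def)
  qed
  moreover have "finite (\<Union>S\<in>?\<S>. A \<rightarrow>\<^sub>E S)"
    by (rule finite_UN_I [OF finS], rule finite_PiE [OF assms(1)], erule fin)
  ultimately have "card {c \<in> colorings r A. card (c ` A) \<le> 2} \<le> card (\<Union>S\<in>?\<S>. A \<rightarrow>\<^sub>E S)"
    by (intro card_mono)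
  also have "\<dots> \<le> (\<Sum>S\<in>?\<S>. card (A \<rightarrow>\<^sub>E S))" by (rule card_UN_le [OF finS])
  also have "\<dots> = (\<Sum>S\<in>?\<S>. 2 ^ card A)"
    using assms by (intro sum.cong) (auto simp: card_PiE)
  also have "\<dots> = (r choose 2) * 2 ^ card A"
    by (simp add: n_subsets)
  finally show ?thesis .
qed

text \<open>If \<open>x\<close> has a third colour, both other points of an AP \<open>(x, y, 2 * y - x)\<close> outside \<open>K\<close> get
  the same colour, so the colours at such \<open>y\<close> are redundant.\<close>

lemma card_colorings_with_exceptions_le:
  fixes n :: nat
  assumes A: "A \<subseteq> {1..n}" and x: "x \<in> K" and K: "K \<subseteq> A" and r: "r \<ge> 1"
  shows "real (card {c \<in> colorings r A. rainbow_3AP_free A c \<and> {v \<in> A. c v \<notin> {a, b}} = K})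
    \<le> real r ^ card K * 2 powr (n - (n / 4 - 3 / 4 - 2 * (real (card ({1..n} - A)) + card K)))"
proof -
  have fin: "finite A" using A finite_subset by blast
  let ?C = "{c \<in> colorings r A. rainbow_3AP_free A c \<and> {v \<in> A. c v \<notin> {a, b}} = K}"
  define Y where "Y = {y \<in> {1..n}. odd (x + y) \<and> x < 2 * y \<and> y \<in> A - K \<and> 2 * y - x \<in> A - K}"
  have YA: "Y \<subseteq> A - K" by (auto simp: Y_def)
  let ?D = "\<lambda>v. if v \<in> K then {1..r} else {a, b}"
  have "card ?C \<le> card (PiE (A - Y) ?D)"
  proof (rule card_inj_on_le [of "\<lambda>c. restrict c (A - Y)"])
    show "inj_on (\<lambda>c. restrict c (A - Y)) ?C"
    proof (rule inj_onI)
      fix c c' assume c: "c \<in> ?C" and c': "c' \<in> ?C" and eq: "restrict c (A - Y) = restrict c' (A - Y)"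
      have agree: "c v = c' v" if "v \<in> A - Y" for v using eq that by (metis restrict_apply')
      have mono: "d y = d (2 * y - x)" if "d \<in> ?C" "y \<in> Y" for d y
      proof -
        have "d x \<notin> {a, b}" using that x by blast
        moreover have "d y \<in> {a, b}" "d (2 * y - x) \<in> {a, b}" using that by (auto simp: Y_def)
        moreover have "d x = d y \<or> d y = d (2 * y - x) \<or> d x = d (2 * y - x)"
        proof (rule rainbow_3AP_free_ap3 [of A d x y "2 * y - x"])
          show "rainbow_3AP_free A d" using that by blast
          show "ap3 x y (2 * y - x)" using that(2) by (intro ap3_extension) (auto simp: Y_def)
          show "x \<in> A" "y \<in> A" "2 * y - x \<in> A" using that(2) x K by (auto simp: Y_def)
        qed
        ultimately show ?thesis by auto
      qed
      have "c v = c' v" if v: "v \<in> A" for v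
      proof (cases "v \<in> Y")
        case True
        \<comment> \<open>\<open>2 * v - x\<close> has the parity of \<open>x\<close> while
          \<open>Y\<close> has the opposite one, so the colour at \<open>v\<close> is read off at a
          point that is never erased itself.\<close>
        then have "2 * v - x \<in> A - Y" by (auto simp: Y_def)
        then show ?thesis using mono [OF c True] mono [OF c' True] agree by metis
      next
        case False
        then show ?thesis using agree v by blast
      qed
      then show "c = c'" using c c' unfolding colorings_def by (intro PiE_ext [of c A _ c']) auto
    qed
    show "(\<lambda>c. restrict c (A - Y)) ` ?C \<subseteq> PiE (A - Y) ?D"
    proof (rule image_subsetI)
      fix c assume c: "c \<in> ?C"
      then have "c v \<in> ?D v" if "v \<in> A" for v using that by (auto simp: colorings_def)
      then show "restrict c (A - Y) \<in> PiE (A - Y) ?D" by auto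
    qed
  qed (use fin in \<open>auto intro!: finite_PiE\<close>)
  also have "\<dots> = (\<Prod>v\<in>A - Y. card (?D v))" by (rule card_PiE) (use fin in auto)
  also have "\<dots> \<le> (\<Prod>v\<in>A - Y. (if v \<in> K then r else 1) * 2)"
    using r by (intro prod_mono) (auto simp: card_insert_if)
  also have "\<dots> = r ^ card K * 2 ^ card (A - Y)"
  proof -
    have "(A - Y) \<inter> K = K" using YA K by auto
    then show ?thesis using fin by (simp add: prod.distrib prod.If_cases)
  qed
  finally have "real (card ?C) \<le> real r ^ card K * 2 powr card (A - Y)"
    by (simp add: powr_realpow flip: of_nat_le_iff [where ?'a = real])
  also have "\<dots> \<le> real r ^ card K * 2 powr (n - (n / 4 - 3 / 4 - 2 * (real (card ({1..n} - A)) + card K)))"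
  proof (intro mult_left_mono powr_mono)
    have "x \<in> {1..n}" using x K A by blast
    then have "real (card Y) \<ge> n / 4 - 3 / 4 - 2 * real (card ({1..n} - (A - K)))"
      using card_extensions_ge [of x n "A - K"] unfolding Y_def of_nat_mult of_nat_numeral by blast
    moreover have "real (card ({1..n} - (A - K))) \<le> real (card ({1..n} - A)) + real (card K)"
    proof -
      have "{1..n} - (A - K) \<subseteq> ({1..n} - A) \<union> K" by auto
      then have "card ({1..n} - (A - K)) \<le> card (({1..n} - A) \<union> K)"
        using K fin finite_subset by (intro card_mono) auto
      also have "\<dots> \<le> card ({1..n} - A) + card K" by (rule card_Un_le)
      finally show ?thesis by simp
    qed
    moreover have "real (card (A - Y)) \<le> n - real (card Y)"
    proof -
      have "card A \<le> n" using card_mono [OF _ A] by simp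
      moreover have "Y \<subseteq> A" using YA by blast
      ultimately show ?thesis using fin card_mono [OF fin \<open>Y \<subseteq> A\<close>]
        by (simp add: card_Diff_subset finite_subset)
    qed
    ultimately show "real (card (A - Y)) \<le> n - (n / 4 - 3 / 4 - 2 * (real (card ({1..n} - A)) + card K))"
      by argo
  qed auto
  finally show ?thesis .
qed

text \<open>Budget of the exponent in units of n/1000: with at most 118 for gaps and 1 for
  exceptions, the tied pairs save 250 - 2 * (118 + 1) = 12. Colouring the exceptions costs 1,
  choosing their set 4, and the choice of \<open>a\<close>, \<open>b\<close> with the additive 3/4
  costs 1 for large \<open>n\<close>. This leaves 6.\<close>

lemma card_nearly_two_colored_le:
  fixes r :: nat
  assumes r: "r \<ge> 2"
  shows "\<exists>\<theta>>0. \<exists>n\<^sub>0::nat. \<forall>n\<ge>n\<^sub>0. \<forall>A. A \<subseteq> {1..n} \<longrightarrow> real (card ({1..n} - A)) \<le> 118 / 1000 * n \<longrightarrow>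
    real (card {c \<in> colorings r A. rainbow_3AP_free A c \<and> (\<exists>a\<in>{1..r}. \<exists>b\<in>{1..r}.
      {v \<in> A. c v \<notin> {a, b}} \<noteq> {} \<and> real (card {v \<in> A. c v \<notin> {a, b}}) \<le> \<theta> * n)})
    \<le> 2 powr ((1 - 6 / 1000) * n)"
proof -
  define l where "l = log 2 (real r)"
  have l: "l \<ge> 1" unfolding l_def using r by (subst le_log_iff) auto
  have rl: "real r = 2 powr l" using r by (simp add: l_def)
  define L where "L = ln (1000 :: real)"
  have L: "L > 0" "exp (- L) = 1 / 1000" by (auto simp: L_def exp_minus)
  \<comment> \<open>The two bounds limit the cost of choosing the exceptional set and the cost of
    colouring it freely.\<close>
  define \<theta> where "\<theta> = min (1 / (1000 * L)) (1 / (1000 * l))"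
  have \<theta>: "\<theta> > 0" using L l by (auto simp: \<theta>_def)
  have \<theta>L: "\<theta> * L \<le> 1 / 1000"
  proof -
    have "\<theta> * L \<le> 1 / (1000 * L) * L" using L by (intro mult_right_mono) (auto simp: \<theta>_def)
    then show ?thesis using L by simp
  qed
  have \<theta>l: "\<theta> * l \<le> 1 / 1000"
  proof -
    have "\<theta> * l \<le> 1 / (1000 * l) * l" using l by (intro mult_right_mono) (auto simp: \<theta>_def)
    then show ?thesis using l by simp
  qed
  have \<theta>1: "\<theta> \<le> 1 / 1000"
  proof -
    have "\<theta> * 1 \<le> \<theta> * l" using l \<theta> by (intro mult_left_mono) auto
    then show ?thesis using \<theta>l by linarith
  qed
  define n0 where "n0 = nat \<lceil>1000 * (2 * l + 1)\<rceil>"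
  have "real (card {c \<in> colorings r A. rainbow_3AP_free A c \<and> (\<exists>a\<in>{1..r}. \<exists>b\<in>{1..r}.
      {v \<in> A. c v \<notin> {a, b}} \<noteq> {} \<and> real (card {v \<in> A. c v \<notin> {a, b}}) \<le> \<theta> * n)})
    \<le> 2 powr ((1 - 6 / 1000) * n)"
    if n: "n \<ge> n0" and A: "A \<subseteq> {1..n}" and m: "real (card ({1..n} - A)) \<le> 118 / 1000 * n" for n A
  proof -
    have n1: "1000 * (2 * l + 1) \<le> n" using n unfolding n0_def by linarith
    have fin: "finite A" using A finite_subset by blast
    have cA: "real (card A) \<le> n" using card_mono [OF _ A] by simp
    let ?C = "\<lambda>a b K. {c \<in> colorings r A. rainbow_3AP_free A c \<and> {v \<in> A. c v \<notin> {a, b}} = K}"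
    define \<K> where "\<K> = {K. K \<subseteq> A \<and> real (card K) \<le> \<theta> * n}"
    have fK: "finite \<K>" unfolding \<K>_def by (rule finite_subset [of _ "Pow A"]) (use fin in auto)
    have "real (card \<K>) \<le> exp (exp (- L) * n + \<theta> * n * L)"
      unfolding \<K>_def using L by (intro card_subsets_le_exp fin cA) auto
    also have "exp (- L) * n + \<theta> * n * L = (1 / 1000 + \<theta> * L) * n"
      by (simp add: L(2) algebra_simps)
    also have "exp \<dots> \<le> exp (2 / 1000 * n)"
      using \<theta>L unfolding exp_le_cancel_iff by (intro mult_right_mono) auto
    also have "\<dots> \<le> 2 powr (2 * (2 / 1000 * n))" by (intro exp_le_two_powr) auto
    finally have cK: "real (card \<K>) \<le> 2 powr (4 / 1000 * n)" by simp
    have C: "real (card (?C a b K)) \<le> 2 powr (n - 11 / 1000 * n + 3 / 4)" if K: "K \<in> \<K> - {{}}" for a b K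
    proof -
      obtain x where x: "x \<in> K" using K by blast
      have K': "K \<subseteq> A" "real (card K) \<le> \<theta> * n" using K by (auto simp: \<K>_def)
      have \<theta>n: "\<theta> * n \<le> 1 / 1000 * n" using \<theta>1 by (intro mult_right_mono) auto
      have "real (card (?C a b K)) \<le> real r ^ card K * 2 powr (n - (n / 4 - 3 / 4 - 2 * (real (card ({1..n} - A)) + card K)))"
        using card_colorings_with_exceptions_le [OF A x K'(1)] r by simp
      also have "\<dots> = 2 powr (l * card K + (n - (n / 4 - 3 / 4 - 2 * (real (card ({1..n} - A)) + card K))))"
        unfolding powr_add by (simp add: rl powr_powr powr_realpow [symmetric])
      also have "\<dots> \<le> 2 powr (n - 11 / 1000 * n + 3 / 4)"
      proof (rule powr_mono)
        have "l * card K \<le> l * (\<theta> * n)" using K' l by (intro mult_left_mono) auto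
        also have "\<dots> = \<theta> * l * n" by simp
        also have "\<dots> \<le> 1 / 1000 * n" using \<theta>l by (intro mult_right_mono) auto
        finally show "l * card K + (n - (n / 4 - 3 / 4 - 2 * (real (card ({1..n} - A)) + card K))) \<le> n - 11 / 1000 * n + 3 / 4"
          using K'(2) m \<theta>n by argo
      qed simp
      finally show ?thesis .
    qed
    let ?F = "\<lambda>p. ?C (fst (fst p)) (snd (fst p)) (snd p)"
    let ?I = "({1..r} \<times> {1..r}) \<times> (\<K> - {{}})"
    have "{c \<in> colorings r A. rainbow_3AP_free A c \<and> (\<exists>a\<in>{1..r}. \<exists>b\<in>{1..r}.
      {v \<in> A. c v \<notin> {a, b}} \<noteq> {} \<and> real (card {v \<in> A. c v \<notin> {a, b}}) \<le> \<theta> * n)}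
      \<subseteq> (\<Union>p\<in>?I. ?F p)" (is "?E \<subseteq> ?U")
    proof
      fix c assume "c \<in> ?E"
      then obtain a b where ab: "a \<in> {1..r}" "b \<in> {1..r}" "{v \<in> A. c v \<notin> {a, b}} \<noteq> {}"
        "real (card {v \<in> A. c v \<notin> {a, b}}) \<le> \<theta> * n" and c: "c \<in> colorings r A" "rainbow_3AP_free A c"
        by blast
      then show "c \<in> ?U"
        by (intro UN_I [of "((a, b), {v \<in> A. c v \<notin> {a, b}})"]) (auto simp: \<K>_def)
    qed
    then have "card ?E \<le> card ?U"
      using fK finite_colorings [OF fin] by (intro card_mono finite_UN_I) auto
    also have "\<dots> \<le> (\<Sum>p\<in>?I. card (?F p))"
      using fK by (intro card_UN_le) simp
    finally have "real (card ?E) \<le> (\<Sum>p\<in>?I. real (card (?F p)))"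
      unfolding of_nat_sum [symmetric] by (rule of_nat_mono)
    also have "\<dots> \<le> (\<Sum>p\<in>?I. 2 powr (n - 11 / 1000 * n + 3 / 4))"
      by (intro sum_mono C) (simp add: mem_Times_iff)
    also have "\<dots> = real r * real r * real (card (\<K> - {{}})) * 2 powr (n - 11 / 1000 * n + 3 / 4)"
      by (simp add: card_cartesian_product)
    also have "\<dots> \<le> 2 powr l * 2 powr l * 2 powr (4 / 1000 * n) * 2 powr (n - 11 / 1000 * n + 3 / 4)"
    proof -
      have "card (\<K> - {{}}) \<le> card \<K>" using fK by (intro card_mono) auto
      then have "real (card (\<K> - {{}})) \<le> 2 powr (4 / 1000 * n)" using cK by linarith
      then show ?thesis unfolding rl by (intro mult_right_mono mult_left_mono) auto
    qed
    also have "\<dots> = 2 powr (2 * l + 3 / 4 + (1 - 7 / 1000) * n)"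
      by (simp add: algebra_simps flip: powr_add)
    also have "\<dots> \<le> 2 powr ((1 - 6 / 1000) * n)"
      using n1 by (intro powr_mono) (auto simp: algebra_simps)
    finally show ?thesis .
  qed
  then show ?thesis using \<theta> by blast
qed

subsection \<open>Covering the rainbow-free colorings\<close>

text \<open>Vertices are point-colour pairs: a coloring becomes its graph, and a set of vertices
  becomes an assignment of colour lists. The range of colours is imposed by the vertex set
  \<open>A \<times> {1..r}\<close>.\<close>

definition rainbow_triples :: "nat set \<Rightarrow> ((nat \<times> nat) \<times> (nat \<times> nat) \<times> (nat \<times> nat)) set" where
  "rainbow_triples A = {((x, i), (y, j), (z, k)) | x y z i j k.
     x \<in> A \<and> y \<in> A \<and> z \<in> A \<and> ap3 x y z \<and> i \<noteq> j \<and> j \<noteq> k \<and> i \<noteq> k}"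

text \<open>Two points leave at most three positions for the third point of a progression, each with
  at most \<open>r\<close> colours.\<close>

lemma triple_system_rainbow_triples:
  assumes "finite A" and "r \<ge> 1"
  shows "triple_system (A \<times> {1..r}) (rainbow_triples A) (3 * r)"
proof
  fix u v w :: "nat \<times> nat"
  show "(v, u, w) \<in> rainbow_triples A" "(u, w, v) \<in> rainbow_triples A" if "(u, v, w) \<in> rainbow_triples A"
    using that by (auto simp: rainbow_triples_def intro: ap3_swap12 ap3_swap23)
next
  fix u v :: "nat \<times> nat"
  obtain x i y j where uv: "u = (x, i)" "v = (y, j)" by fastforce
  let ?Z = "{2 * y - x, (x + y) div 2, 2 * x - y}"
  have "{w \<in> A \<times> {1..r}. (u, v, w) \<in> rainbow_triples A} \<subseteq> ?Z \<times> {1..r}"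
    using ap3_third uv by (fastforce simp: rainbow_triples_def)
  then have "card {w \<in> A \<times> {1..r}. (u, v, w) \<in> rainbow_triples A} \<le> card (?Z \<times> {1..r})"
    by (intro card_mono) auto
  also have "\<dots> \<le> 3 * r"
    unfolding card_cartesian_product by (intro mult_mono) (auto simp: card_insert_if)
  finally show "card {w \<in> A \<times> {1..r}. (u, v, w) \<in> rainbow_triples A} \<le> 3 * r" .
qed (use assms in auto)

lemma rainbow_3AP_free_independent:
  assumes "rainbow_3AP_free A c" and "I = (\<lambda>x. (x, c x)) ` A"
  shows "rainbow_triples A \<inter> I \<times> I \<times> I = {}"
  using rainbow_3AP_free_ap3 [OF assms(1)] unfolding rainbow_triples_def assms(2) by blast

lemma card_rainbow_aps_le:
  assumes "finite C"
  shows "card (rainbow_aps A (\<lambda>x. {i. (x, i) \<in> C})) \<le> card (rainbow_triples A \<inter> C \<times> C \<times> C)"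
proof (rule surj_card_le)
  show "rainbow_aps A (\<lambda>x. {i. (x, i) \<in> C})
      \<subseteq> (\<lambda>(u, v, w). (fst u, fst v, fst w)) ` (rainbow_triples A \<inter> C \<times> C \<times> C)"
  proof
    fix t assume "t \<in> rainbow_aps A (\<lambda>x. {i. (x, i) \<in> C})"
    then obtain x y z i j k where "t = (x, y, z)" "x \<in> A" "y \<in> A" "z \<in> A" "ap3 x y z"
      "(x, i) \<in> C" "(y, j) \<in> C" "(z, k) \<in> C" "i \<noteq> j" "j \<noteq> k" "i \<noteq> k"
      by (auto simp: rainbow_aps_def)
    then show "t \<in> (\<lambda>(u, v, w). (fst u, fst v, fst w)) ` (rainbow_triples A \<inter> C \<times> C \<times> C)"
      by (intro image_eqI [of _ _ "((x, i), (y, j), (z, k))"]) (auto simp: rainbow_triples_def)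
  qed
qed (use assms in auto)

text \<open>A container with a small product of list sizes is charged that product. In any other
  container a coloring agrees with one pair of colours up to \<open>\<theta> * n\<close> points, and
  its third colour makes the exceptional set nonempty. The class \<open>E\<close> of all such
  colorings is counted once, so its bound is not multiplied by the number of containers.\<close>

lemma card_many_colored_le:
  fixes r :: nat and \<xi> :: real
  assumes r: "r \<ge> 3" and \<xi>: "0 < \<xi>" "\<xi> \<le> 3 / (13 + 8 * log 2 (real r))"
  shows "\<exists>\<gamma>>0. \<exists>n\<^sub>0::nat. \<forall>n\<ge>n\<^sub>0. \<forall>A. A \<subseteq> {1..n} \<longrightarrow> real (card A) \<ge> (1 - \<xi>) * n \<longrightarrow>
    real (card {c \<in> colorings r A. rainbow_3AP_free A c \<and> card (c ` A) > 2})
      \<le> 2 powr ((1 - \<gamma>) * n) + 2 powr ((1 - 6 / 1000) * n)"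
proof -
  have r2: "r \<ge> 2" using r by simp
  obtain \<theta> and n1 :: nat where \<theta>: "\<theta> > 0" and n1: "\<forall>n\<ge>n1. \<forall>A. A \<subseteq> {1..n} \<longrightarrow>
    real (card ({1..n} - A)) \<le> 118 / 1000 * n \<longrightarrow>
    real (card {c \<in> colorings r A. rainbow_3AP_free A c \<and> (\<exists>a\<in>{1..r}. \<exists>b\<in>{1..r}.
      {v \<in> A. c v \<notin> {a, b}} \<noteq> {} \<and> real (card {v \<in> A. c v \<notin> {a, b}}) \<le> \<theta> * n)})
    \<le> 2 powr ((1 - 6 / 1000) * n)"
    using card_nearly_two_colored_le [OF r2] by (elim exE conjE) (rule that)
  obtain \<gamma> \<delta> and n2 :: nat where \<gamma>: "\<gamma> > 0" and \<delta>: "\<delta> > 0"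
    and n2: "\<forall>n\<ge>n2. \<forall>A (P :: nat \<Rightarrow> nat set). A \<subseteq> {1..n} \<longrightarrow> real (card A) \<ge> (1 - \<xi>) * n \<longrightarrow>
    (\<forall>x\<in>A. P x \<noteq> {} \<and> finite (P x) \<and> card (P x) \<le> r) \<longrightarrow>
    real (card (rainbow_aps A P)) \<le> \<delta> * (real n)\<^sup>2 \<longrightarrow>
    (\<Prod>x\<in>A. real (card (P x))) \<le> 2 powr ((1 - \<gamma>) * n) \<or>
    (\<exists>x0\<in>A. card (P x0) = 2 \<and> real (card {x \<in> A. P x \<noteq> P x0}) \<le> \<theta> * n)"
    using template_dichotomy [OF r \<xi> \<theta>] by (elim exE conjE) (rule that)
  \<comment> \<open>Containers are taken with \<open>N = r * n\<close>, so
    \<open>\<delta>' * N\<^sup>2\<close> equals \<open>\<delta> * n\<^sup>2\<close>. The choice of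
    \<open>\<epsilon>\<close> limits the containers to \<open>2 powr (\<gamma> / 2 * n)\<close>,
    half of the saving.\<close>
  define \<delta>' where "\<delta>' = \<delta> / (real r)\<^sup>2"
  define \<epsilon> where "\<epsilon> = \<gamma> / (4 * r)"
  have pos: "\<delta>' > 0" "\<epsilon> > 0" "3 * r \<ge> 1" using \<delta> \<gamma> r by (auto simp: \<delta>'_def \<epsilon>_def)
  obtain N3 where N3: "\<forall>N\<ge>N3. \<forall>(V :: (nat \<times> nat) set) H. triple_system V H (3 * r) \<longrightarrow>
    real (card V) \<le> N \<longrightarrow>
    (\<exists>\<C>. finite \<C> \<and> real (card \<C>) \<le> exp (\<epsilon> * N)
    \<and> (\<forall>C\<in>\<C>. C \<subseteq> V \<and> real (card (H \<inter> C \<times> C \<times> C)) < \<delta>' * N\<^sup>2)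
    \<and> (\<forall>I\<subseteq>V. H \<inter> I \<times> I \<times> I = {} \<longrightarrow> (\<exists>C\<in>\<C>. I \<subseteq> C)))"
    using triple_containers [OF pos] by (elim exE) (rule that)
  define n0 where "n0 = max (max n1 n2) (nat \<lceil>N3\<rceil>)"
  have main: "real (card {c \<in> colorings r A. rainbow_3AP_free A c \<and> card (c ` A) > 2})
      \<le> 2 powr ((1 - \<gamma> / 2) * n) + 2 powr ((1 - 6 / 1000) * n)" (is "real (card ?M) \<le> _")
    if n: "n \<ge> n0" and A: "A \<subseteq> {1..n}" and cA: "real (card A) \<ge> (1 - \<xi>) * n" for n A
  proof -
    have fin: "finite A" using A finite_subset by blast
    define N where "N = real r * n"
    have "real n \<ge> N3" using n unfolding n0_def by linarith
    moreover have "N \<ge> 1 * real n" unfolding N_def using r by (intro mult_right_mono) auto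
    ultimately have N: "N \<ge> N3" by simp
    have cA': "card A \<le> n" using card_mono [OF _ A] by simp
    define V where "V = A \<times> {1..r}"
    have "card V = r * card A" by (simp add: V_def card_cartesian_product)
    then have V: "real (card V) \<le> N" using cA' by (simp add: N_def mult_left_mono)
    have finV: "finite V" using fin by (simp add: V_def)
    have ts: "triple_system V (rainbow_triples A) (3 * r)"
      unfolding V_def using triple_system_rainbow_triples [OF fin] r by simp
    obtain \<C> where \<C>: "finite \<C>" "real (card \<C>) \<le> exp (\<epsilon> * N)"
      "\<forall>C\<in>\<C>. C \<subseteq> V \<and> real (card (rainbow_triples A \<inter> C \<times> C \<times> C)) < \<delta>' * N\<^sup>2"
      "\<forall>I\<subseteq>V. rainbow_triples A \<inter> I \<times> I \<times> I = {} \<longrightarrow> (\<exists>C\<in>\<C>. I \<subseteq> C)"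
      using N3 [rule_format, OF N ts V] by (elim exE conjE) (rule that)
    have \<C>V: "C \<subseteq> V" and sparse: "real (card (rainbow_triples A \<inter> C \<times> C \<times> C)) < \<delta>' * N\<^sup>2"
      if "C \<in> \<C>" for C using \<C>(3) that by auto
    define lists where "lists C = (\<lambda>x. {i :: nat. (x, i) \<in> C})" for C :: "(nat \<times> nat) set"
    have lists: "lists C x \<subseteq> {1..r}" if "C \<in> \<C>" for C x
      using \<C>V [OF that] by (auto simp: lists_def V_def)
    have finlists: "finite (lists C x)" if "C \<in> \<C>" for C x
      using lists [OF that] finite_subset by blast
    define \<G> where "\<G> = {C \<in> \<C>. (\<Prod>x\<in>A. real (card (lists C x))) \<le> 2 powr ((1 - \<gamma>) * n)}"
    define E where "E = {c \<in> colorings r A. rainbow_3AP_free A c \<and> (\<exists>a\<in>{1..r}. \<exists>b\<in>{1..r}.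
      {v \<in> A. c v \<notin> {a, b}} \<noteq> {} \<and> real (card {v \<in> A. c v \<notin> {a, b}}) \<le> \<theta> * n)}"
    have finG: "finite \<G>" using \<C>(1) by (simp add: \<G>_def)
    have finE: "finite E" using finite_colorings [OF fin] by (simp add: E_def)
    have "?M \<subseteq> (\<Union>C\<in>\<G>. PiE A (lists C)) \<union> E"
    proof
      fix c assume "c \<in> ?M"
      then have c: "c \<in> colorings r A" "rainbow_3AP_free A c" "card (c ` A) > 2" by auto
      let ?I = "(\<lambda>x. (x, c x)) ` A"
      have "?I \<subseteq> V" using c(1) by (auto simp: V_def colorings_def)
      then obtain C where C: "C \<in> \<C>" "?I \<subseteq> C"
        using \<C>(4) rainbow_3AP_free_independent [OF c(2) refl] by blast
      have cC: "c x \<in> lists C x" if "x \<in> A" for x using C(2) that by (auto simp: lists_def)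
      have "real (card (rainbow_aps A (lists C))) \<le> \<delta> * (real n)\<^sup>2"
      proof -
        have "card (rainbow_aps A (lists C)) \<le> card (rainbow_triples A \<inter> C \<times> C \<times> C)"
          unfolding lists_def using \<C>V [OF C(1)] finV finite_subset
          by (intro card_rainbow_aps_le) blast
        then have "real (card (rainbow_aps A (lists C))) \<le> \<delta>' * N\<^sup>2"
          using sparse [OF C(1)] by linarith
        also have "\<dots> = \<delta> * (real n)\<^sup>2" using r by (simp add: \<delta>'_def N_def power_mult_distrib)
        finally show ?thesis .
      qed
      moreover have "\<forall>x\<in>A. lists C x \<noteq> {} \<and> finite (lists C x) \<and> card (lists C x) \<le> r"
        using cC finlists [OF C(1)] card_mono [OF _ lists [OF C(1)]] by fastforce
      moreover have "n \<ge> n2" using n by (simp add: n0_def)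
      ultimately consider "(\<Prod>x\<in>A. real (card (lists C x))) \<le> 2 powr ((1 - \<gamma>) * n)"
        | x0 where "x0 \<in> A" "card (lists C x0) = 2" "real (card {x \<in> A. lists C x \<noteq> lists C x0}) \<le> \<theta> * n"
        using n2 [rule_format, OF _ A cA, of "lists C"] by blast
      then show "c \<in> (\<Union>C\<in>\<G>. PiE A (lists C)) \<union> E"
      proof cases
        case 1
        then have "C \<in> \<G>" using C by (simp add: \<G>_def)
        moreover have "c \<in> PiE A (lists C)" using c(1) cC by (auto simp: colorings_def PiE_def)
        ultimately show ?thesis by blast
      next
        case (2 x0)
        obtain a b where ab: "lists C x0 = {a, b}" using 2(2) by (auto simp: card_2_iff)
        have abr: "a \<in> {1..r}" "b \<in> {1..r}" using lists [OF C(1), of x0] ab by auto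
        let ?K = "{v \<in> A. c v \<notin> {a, b}}"
        have "?K \<subseteq> {x \<in> A. lists C x \<noteq> lists C x0}" using cC ab by auto
        then have "card ?K \<le> card {x \<in> A. lists C x \<noteq> lists C x0}" using fin by (intro card_mono) auto
        then have "real (card ?K) \<le> \<theta> * n" using 2(3) by linarith
        moreover have "?K \<noteq> {}"
        proof
          assume "?K = {}"
          then have "c ` A \<subseteq> {a, b}" by auto
          then have "card (c ` A) \<le> card {a, b}" by (intro card_mono) auto
          also have "\<dots> \<le> 2" by (simp add: card_insert_if)
          finally show False using c(3) by simp
        qed
        ultimately have "c \<in> E" using c abr unfolding E_def by blast
        then show ?thesis by blast
      qed
    qed
    moreover have finU: "finite (\<Union>C\<in>\<G>. PiE A (lists C))"
      using finG fin finlists by (intro finite_UN_I finite_PiE) (auto simp: \<G>_def)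
    ultimately have "card ?M \<le> card ((\<Union>C\<in>\<G>. PiE A (lists C)) \<union> E)"
      using finE by (intro card_mono) auto
    also have "\<dots> \<le> card (\<Union>C\<in>\<G>. PiE A (lists C)) + card E" by (rule card_Un_le)
    finally have "real (card ?M) \<le> real (card (\<Union>C\<in>\<G>. PiE A (lists C))) + real (card E)" by simp
    also have "real (card (\<Union>C\<in>\<G>. PiE A (lists C))) \<le> (\<Sum>C\<in>\<G>. real (card (PiE A (lists C))))"
      unfolding of_nat_sum [symmetric] by (intro of_nat_mono card_UN_le finG)
    also have "\<dots> \<le> (\<Sum>C\<in>\<G>. 2 powr ((1 - \<gamma>) * n))"
    proof (rule sum_mono)
      fix C assume "C \<in> \<G>"
      then show "real (card (PiE A (lists C))) \<le> 2 powr ((1 - \<gamma>) * n)"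
        using card_PiE [OF fin, of "lists C"] by (simp add: \<G>_def)
    qed
    also have "\<dots> = real (card \<G>) * 2 powr ((1 - \<gamma>) * n)" by simp
    also have "\<dots> \<le> 2 powr (\<gamma> / 2 * n) * 2 powr ((1 - \<gamma>) * n)"
    proof (rule mult_right_mono)
      have "card \<G> \<le> card \<C>" using \<C>(1) by (intro card_mono) (auto simp: \<G>_def)
      then have "real (card \<G>) \<le> exp (\<epsilon> * N)" using \<C>(2) by linarith
      also have "\<epsilon> * N = \<gamma> / 4 * n" using r by (simp add: \<epsilon>_def N_def)
      also have "exp \<dots> \<le> 2 powr (2 * (\<gamma> / 4 * n))" using \<gamma> by (intro exp_le_two_powr) auto
      finally show "real (card \<G>) \<le> 2 powr (\<gamma> / 2 * n)" by simp
    qed simp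
    also have "\<dots> = 2 powr ((1 - \<gamma> / 2) * n)" by (simp add: algebra_simps flip: powr_add)
    also have "real (card E) \<le> 2 powr ((1 - 6 / 1000) * n)"
      unfolding E_def
    proof (rule n1 [rule_format, OF _ A])
      show "n \<ge> n1" using n by (simp add: n0_def)
      have "real (card ({1..n} - A)) = n - real (card A)"
        using card_Diff_subset [OF fin A] cA' by simp
      also have "\<dots> \<le> \<xi> * n" using cA by (simp add: algebra_simps)
      also have "\<dots> \<le> 118 / 1000 * n"
        using \<xi>(2) threshold_le [OF r] by (intro mult_right_mono) auto
      finally show "real (card ({1..n} - A)) \<le> 118 / 1000 * n" .
    qed
    finally show ?thesis by simp
  qed
  have "\<gamma> / 2 > 0" using \<gamma> by simp
  then show ?thesis
    by (intro exI [of _ "\<gamma> / 2"] conjI exI [of _ n0] allI impI main)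
qed

section \<open>From a linear saving in the exponent to the stated error term\<close>

theorem theorem1p2:
  fixes r :: nat and \<xi> :: real
  assumes "r \<ge> 3" and "0 < \<xi>" and "\<xi> \<le> 3 / (13 + 8 * log 2 (real r))"
  shows "\<exists>n\<^sub>0::nat. \<forall>n::nat. n \<ge> n\<^sub>0 \<longrightarrow>
    (\<forall>A::nat set. A \<subseteq> {1..n} \<and> real (card A) \<ge> (1 - \<xi>) * real n \<longrightarrow>
      real (num_rainbow_free r A) \<le> real (r choose 2) * 2 ^ card A
        + 2 powr (- (real n / (36 * log 2 (real n)))) * 2 ^ n)"
proof -
  obtain \<gamma> and n1 :: nat where \<gamma>: "\<gamma> > 0" and n1: "\<forall>n\<ge>n1. \<forall>A. A \<subseteq> {1..n} \<longrightarrow>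
    real (card A) \<ge> (1 - \<xi>) * n \<longrightarrow>
    real (card {c \<in> colorings r A. rainbow_3AP_free A c \<and> card (c ` A) > 2})
      \<le> 2 powr ((1 - \<gamma>) * n) + 2 powr ((1 - 6 / 1000) * n)"
    using card_many_colored_le [OF assms] by (elim exE conjE) (rule that)
  define \<kappa> where "\<kappa> = min \<gamma> (6 / 1000)"
  have \<kappa>: "\<kappa> > 0" "\<kappa> \<le> \<gamma>" "\<kappa> \<le> 6 / 1000" using \<gamma> by (auto simp: \<kappa>_def)
  \<comment> \<open>Half of the saving \<open>\<kappa> * n\<close> absorbs the factor 2 from adding
    two equal terms, once \<open>n \<ge> 2 / \<kappa>\<close>. The other half dominates
    \<open>n / (36 * log 2 n)\<close> once \<open>18 * \<kappa> * log 2 n \<ge> 1\<close>.\<close>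
  define n0 where "n0 = max (max n1 2) (max (nat \<lceil>2 / \<kappa>\<rceil>) (nat \<lceil>2 powr (1 / (18 * \<kappa>))\<rceil>))"
  have main: "real (num_rainbow_free r A) \<le> real (r choose 2) * 2 ^ card A
        + 2 powr (- (real n / (36 * log 2 (real n)))) * 2 ^ n"
    if n: "n \<ge> n0" and A: "A \<subseteq> {1..n}" and cA: "real (card A) \<ge> (1 - \<xi>) * n" for n A
  proof -
    have fin: "finite A" using A finite_subset by blast
    have nn: "n \<ge> n1" "n \<ge> 2" using n by (auto simp: n0_def)
    have "2 / \<kappa> \<le> n" using n unfolding n0_def by linarith
    then have k1: "1 \<le> \<kappa> / 2 * n" using \<kappa> by (simp add: field_simps)
    have "2 powr (1 / (18 * \<kappa>)) \<le> n" using n unfolding n0_def by linarith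
    then have "1 / (18 * \<kappa>) \<le> log 2 n" using nn by (subst le_log_iff) auto
    then have k2: "1 \<le> 18 * \<kappa> * log 2 n" using \<kappa> by (simp add: field_simps)
    have log0: "log 2 (real n) > 0" using nn by simp
    have k3: "n / (36 * log 2 n) \<le> \<kappa> / 2 * n"
    proof -
      have "real n * 1 \<le> n * (18 * \<kappa> * log 2 n)" by (rule mult_left_mono [OF k2]) simp
      then show ?thesis using log0 by (simp add: field_simps)
    qed
    let ?M = "{c \<in> colorings r A. rainbow_3AP_free A c \<and> card (c ` A) > 2}"
    let ?T = "{c \<in> colorings r A. card (c ` A) \<le> 2}"
    have "num_rainbow_free r A \<le> card (?T \<union> ?M)"
      unfolding num_rainbow_free_def using finite_colorings [OF fin] by (intro card_mono) auto
    also have "\<dots> \<le> card ?T + card ?M" by (rule card_Un_le)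
    also have "card ?T \<le> (r choose 2) * 2 ^ card A"
      using assms by (intro card_two_colored_le fin) auto
    finally have "real (num_rainbow_free r A) \<le> real ((r choose 2) * 2 ^ card A + card ?M)"
      by (simp only: of_nat_le_iff)
    also have "\<dots> = real (r choose 2) * 2 ^ card A + real (card ?M)" by simp
    also have "real (card ?M) \<le> 2 powr ((1 - \<gamma>) * n) + 2 powr ((1 - 6 / 1000) * n)"
      by (rule n1 [rule_format, OF nn(1) A cA])
    also have "\<dots> \<le> 2 powr ((1 - \<kappa>) * n) + 2 powr ((1 - \<kappa>) * n)"
      using \<kappa> by (intro add_mono powr_mono mult_right_mono) auto
    also have "\<dots> = 2 powr (1 + (1 - \<kappa>) * n)" by (simp add: powr_add)
    also have "\<dots> \<le> 2 powr (- (n / (36 * log 2 n)) + n)"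
    proof (rule powr_mono)
      have "(1 - \<kappa>) * n = n - \<kappa> / 2 * n - \<kappa> / 2 * n" by (simp add: algebra_simps)
      then show "1 + (1 - \<kappa>) * n \<le> - (n / (36 * log 2 n)) + n" using k1 k3 by linarith
    qed simp
    also have "\<dots> = 2 powr (- (real n / (36 * log 2 (real n)))) * 2 ^ n"
      unfolding powr_add by (simp add: powr_realpow)
    finally show ?thesis by simp
  qed
  then show ?thesis by (intro exI [of _ n0] allI impI main) auto
qed

end
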